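(* Let $n,m,\delta$ be positive integers such that $\delta \geq \max\{n, \frac{m+10}{4}\}$. Then every $3$-connected $n$-vertex hypergraph with $m$ edges and minimum degree at least $\delta$ has a hamiltonian Berge cycle.
   Context: A hypergraph $\mathcal{H}$ consists of a finite set of vertices $V(\mathcal{H})$ and a set of edges $E(\mathcal{H})$, where each edge is a subset of $V(\mathcal{H})$ (edges may have any size). The degree of a vertex $v$ is the number of edges containing $v$, and the minimum degree of $\mathcal{H}$ is the minimum of the degrees of its vertices. A Berge cycle of length $\ell$ in a hypergraph consists of $\ell$ distinct vertices $v_1,\ldots,v_\ell$ (the base vertices) and $\ell$ distinct edges $e_1,\ldots,e_\ell$ such that $v_i,v_{i+1}\in e_i$ for every $i\in\{1,\dots,\ell\}$ (indices modulo $\ell$). A hamiltonian Berge cycle in $\mathcal{H}$ is a Berge cycle whose set of base vertices is $V(\mathcal{H})$. The incidence graph $I(\mathcal{H})$ is the bipartite graph with parts $X=V(\mathcal{H})$ and $Y=E(\mathcal{H})$ in which $v\in X$ and $e\in Y$ are adjacent if and only if $v\in e$. A hypergraph is called $k$-connected if its incidence graph is a $k$-connected graph, where a graph is $k$-connected if it has more than $k$ vertices and remains connected after the deletion of any set of fewer than $k$ vertices. *)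

theory Defs
  imports Complex_Main "Graph_Theory.Digraph_Component"
begin

locale hypergraph =
  fixes V :: "'a set" and E :: "'a set set"
  assumes finite_vertices: "finite V"
    and edge_subset: "e \<in> E \<Longrightarrow> e \<subseteq> V"

definition hdegree :: "'a set set \<Rightarrow> 'a \<Rightarrow> nat" where
  "hdegree E v = card {e \<in> E. v \<in> e}"

definition min_hdegree :: "'a set \<Rightarrow> 'a set set \<Rightarrow> nat" where
  "min_hdegree V E = Min (hdegree E ` V)"

text \<open>The lists hold the base vertices and the edges in cyclic order, numbered from 0 instead of 1.
  Edges are compared as sets, so \<^term>\<open>distinct es\<close> is distinctness in \<^term>\<open>E\<close>.\<close>

definition berge_cycle :: "'a set \<Rightarrow> 'a set set \<Rightarrow> nat \<Rightarrow> 'a list \<Rightarrow> 'a set list \<Rightarrow> bool" where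
  "berge_cycle V E l vs es \<longleftrightarrow>
     0 < l \<and> length vs = l \<and> length es = l \<and>
     distinct vs \<and> set vs \<subseteq> V \<and> distinct es \<and> set es \<subseteq> E \<and>
     (\<forall>i<l. vs ! i \<in> es ! i \<and> vs ! (Suc i mod l) \<in> es ! i)"

definition has_hamiltonian_berge_cycle :: "'a set \<Rightarrow> 'a set set \<Rightarrow> bool" where
  "has_hamiltonian_berge_cycle V E \<longleftrightarrow>
     (\<exists>l vs es. berge_cycle V E l vs es \<and> set vs = V)"

text \<open>Undirected graphs are symmetric digraphs. The sum type keeps the two parts disjoint.\<close>

definition incidence_graph :: "'a set \<Rightarrow> 'a set set \<Rightarrow> ('a + 'a set) pair_pre_digraph" where
  "incidence_graph V E =
     \<lparr> pverts = Inl ` V \<union> Inr ` E,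
       parcs = {(Inl v, Inr e) | v e. v \<in> V \<and> e \<in> E \<and> v \<in> e} \<union>
               {(Inr e, Inl v) | v e. v \<in> V \<and> e \<in> E \<and> v \<in> e} \<rparr>"

lemma (in hypergraph) pair_graph_incidence_graph: "pair_graph (incidence_graph V E)"
proof -
  let ?I = "incidence_graph V E"
  have "E \<subseteq> Pow V"
    using edge_subset by auto
  then have "finite E"
    using finite_vertices by (meson finite_Pow_iff finite_subset)
  then have fin: "finite (pverts ?I)"
    using finite_vertices by (simp add: incidence_graph_def)
  have sub: "parcs ?I \<subseteq> pverts ?I \<times> pverts ?I"
    by (auto simp: incidence_graph_def)
  then have "finite (parcs ?I)"
    using fin finite_subset by blast
  moreover have "symmetric (with_proj ?I)"
    by (auto simp: symmetric_def incidence_graph_def intro!: symI)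
  moreover have "fst a \<noteq> snd a" if "a \<in> parcs ?I" for a
    using that by (auto simp: incidence_graph_def)
  ultimately show ?thesis
    using fin sub by unfold_locales auto
qed

text \<open>The name \<open>connected\<close> alone could denote topological connectedness.\<close>

definition k_connected :: "nat \<Rightarrow> ('b, 'c) pre_digraph \<Rightarrow> bool" where
  "k_connected k G \<longleftrightarrow>
     card (verts G) > k \<and>
     (\<forall>S \<subseteq> verts G. card S < k \<longrightarrow> Digraph_Component.connected (G \<restriction> (verts G - S)))"

definition k_connected_hypergraph :: "nat \<Rightarrow> 'a set \<Rightarrow> 'a set set \<Rightarrow> bool" where
  "k_connected_hypergraph k V E \<longleftrightarrow> k_connected k (with_proj (incidence_graph V E))"

end

theory Submission
  imports Defs
begin

text \<open>Take a longest cycle C, with c < n \<le> \<delta> base vertices, and a component of what lies outside C.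
  A path with c + 1 base vertices cannot be closed to a cycle; so its ends have no common edge outside
  it, and crossing edges at its ends only produce longest cycles that lose one vertex. The ends and the
  lost vertices have pairwise disjoint neighbourhoods outside the path, so with only 4\<delta> - 10 edges
  there cannot be many of them. An extremal choice of C then shows that a vertex outside a longest cycle
  lies on at most three edges of it, and that the cycle successors of two attachments of the component
  lie on at most c + 3 edges of C altogether.

  Hence the component is attached through exactly three gates: fewer contradict 3-connectedness, and
  with four the pairwise disjoint neighbourhoods of the successors and of the component need too many
  edges. As edges are distinct sets with at least three elements, a component with three gates
  has at least three vertices, and any two of them lie on at least four common edges. So any two
  attachments are joined through the component by a path with three vertices. Closing up with such
  paths restricts the order in which the three successors meet the edges along C: they lie on at most
  c + 6 edges of C altogether, which contradicts the edge count a last time.\<close>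

section \<open>Cuts and alternating paths\<close>

text \<open>The obstacle is that an edge may contain many vertices but may be used only once. Hence
  the two ends of a path can lie on more path edges than a Dirac-type count allows; the excess is
  bounded by the number of lost vertices. A lost vertex of a path with c + 1 vertices is outside
  another longest cycle with the same edge set, so every bound on the contacts of outside vertices
  applies to it as well. This feedback is what makes the extremal choice of C effective. The factor
  4 reflects four disjoint blocks of edges off the cycle: the blocks at the successors of three
  gates, and the edges of the component. A block has \<delta> edges less the contacts with cycle
  edges, so everything turns on bounding those contacts. The constant 10 leaves a margin of exactly
  one in \<open>card_lost_le_1\<close> and in the last count. Separators live in the incidence graph
  and mix vertices with edges; this is why gates are of both kinds.\<close>

lemma arcs_ends_incidence_restrict:
  assumes "(p, q) \<in> (arcs_ends (with_proj (incidence_graph V E) \<restriction> U))\<^sup>s"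
  shows "q \<in> U \<and> (\<exists>v e. v \<in> V \<and> e \<in> E \<and> v \<in> e \<and>
    (p = Inl v \<and> q = Inr e \<or> p = Inr e \<and> q = Inl v))"
  using assms unfolding symcl_def
  by (auto simp: arcs_ends_def arc_to_ends_def incidence_graph_def induce_subgraph_def)

text \<open>\<open>RX\<close> and \<open>RY\<close> form a set that no arc of the incidence graph
  leaves once \<open>SX\<close> and \<open>SY\<close> are deleted, hence a union of components of
  the remainder. Deleting at most two vertices leaves a single component. In this form
  3-connectedness can be used without returning to the incidence graph.\<close>

lemma three_connected_cut:
  assumes hyp: "hypergraph V E" and conn: "k_connected_hypergraph 3 V E"
    and sub: "SX \<subseteq> V" "SY \<subseteq> E" "RX \<subseteq> V" "RY \<subseteq> E"
    and small: "card SX + card SY \<le> 2"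
    and disj: "RX \<inter> SX = {}" "RY \<inter> SY = {}"
    and ne: "RX \<noteq> {} \<or> RY \<noteq> {}"
    and closed_X: "\<And>v e. v \<in> RX \<Longrightarrow> e \<in> E \<Longrightarrow> v \<in> e \<Longrightarrow> e \<in> RY \<union> SY"
    and closed_Y: "\<And>v e. e \<in> RY \<Longrightarrow> v \<in> e \<Longrightarrow> v \<in> RX \<union> SX"
  shows "V \<subseteq> RX \<union> SX \<and> E \<subseteq> RY \<union> SY"
proof -
  let ?G = "with_proj (incidence_graph V E)"
  let ?S = "Inl ` SX \<union> Inr ` SY :: ('a + 'a set) set"
  let ?R = "Inl ` RX \<union> Inr ` RY :: ('a + 'a set) set"
  let ?U = "verts ?G - ?S"
  have verts: "verts ?G = Inl ` V \<union> Inr ` E"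
    by (simp add: incidence_graph_def)
  have "card ?S \<le> card SX + card SY"
    by (rule order_trans[OF card_Un_le]) (simp add: card_image)
  then have "card ?S < 3" using small by linarith
  moreover have "?S \<subseteq> verts ?G" using sub verts by auto
  ultimately have "Digraph_Component.connected (?G \<restriction> ?U)"
    using conn unfolding k_connected_hypergraph_def k_connected_def by blast
  then have reach: "(p, q) \<in> rtrancl_on ?U ((arcs_ends (?G \<restriction> ?U))\<^sup>s)" if "p \<in> ?U" "q \<in> ?U" for p q
    using that by (simp add: connected_conv)
  have stay: "q \<in> ?R" if "(p, q) \<in> rtrancl_on ?U ((arcs_ends (?G \<restriction> ?U))\<^sup>s)" "p \<in> ?R" for p q
    using that
  proof (induction rule: rtrancl_on_induct)
    case (step q r)
    from arcs_ends_incidence_restrict[OF step(2)] obtain v e where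
      ve: "r \<in> ?U" "v \<in> V" "e \<in> E" "v \<in> e" "q = Inl v \<and> r = Inr e \<or> q = Inr e \<and> r = Inl v"
      by auto
    have "q \<in> ?R" using step by blast
    then show ?case using ve closed_X[of v e] closed_Y[of e v] by auto
  qed auto
  have RU: "?R \<subseteq> ?U" using sub disj verts by auto
  obtain r where "r \<in> ?R" using ne by auto
  then have all: "?U \<subseteq> ?R" using reach stay RU by blast
  show ?thesis
  proof (intro conjI subsetI)
    fix v assume "v \<in> V"
    then show "v \<in> RX \<union> SX" using all[THEN subsetD, of "Inl v"] verts by auto
  next
    fix e assume "e \<in> E"
    then show "e \<in> RY \<union> SY" using all[THEN subsetD, of "Inr e"] verts by auto
  qed
qed

text \<open>Repetitions are allowed, so that joining, cutting and reversing need no side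
  conditions.\<close>

definition bpath :: "'a list \<Rightarrow> 'a set list \<Rightarrow> bool" where
  "bpath vs es \<longleftrightarrow> length vs = Suc (length es) \<and>
     (\<forall>i<length es. vs ! i \<in> es ! i \<and> vs ! Suc i \<in> es ! i)"

lemma bpath_single [simp]: "bpath [v] []"
  by (simp add: bpath_def)

lemma bpath_not_Nil: "bpath vs es \<Longrightarrow> vs \<noteq> []"
  by (auto simp: bpath_def)

lemma bpath_join:
  assumes "bpath vs es" "bpath vs' es'" "last vs \<in> e" "hd vs' \<in> e"
  shows "bpath (vs @ vs') (es @ e # es')"
  unfolding bpath_def
proof (intro conjI allI impI)
  have len: "length vs = Suc (length es)" "length vs' = Suc (length es')"
    using assms by (auto simp: bpath_def)
  then show "length (vs @ vs') = Suc (length (es @ e # es'))" by simp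
  have ends: "vs ! length es \<in> e" "vs' ! 0 \<in> e"
    using assms len by (auto simp: last_conv_nth hd_conv_nth bpath_not_Nil)
  fix i assume i: "i < length (es @ e # es')"
  consider "i < length es" | "i = length es" | j where "i = Suc (length es + j)" "j < length es'"
  proof (cases i "length es" rule: linorder_cases)
    case greater
    then have "i = Suc (length es + (i - Suc (length es)))" "i - Suc (length es) < length es'"
      using i by auto
    then show ?thesis using that(3) by blast
  qed (use that in auto)
  then have "(vs @ vs') ! i \<in> (es @ e # es') ! i \<and> (vs @ vs') ! Suc i \<in> (es @ e # es') ! i"
  proof cases
    case 1 then show ?thesis using assms(1) len by (auto simp: bpath_def nth_append)
  next
    case 2 then show ?thesis using ends len by (auto simp: nth_append)
  next
    case 3 then show ?thesis using assms(2) len by (auto simp: bpath_def nth_append nth_Cons')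
  qed
  then show "(vs @ vs') ! i \<in> (es @ e # es') ! i" "(vs @ vs') ! Suc i \<in> (es @ e # es') ! i"
    by auto
qed

lemma bpath_rev: "bpath vs es \<Longrightarrow> bpath (rev vs) (rev es)"
  unfolding bpath_def
proof (elim conjE, intro conjI allI impI)
  assume len: "length vs = Suc (length es)"
    and inc: "\<forall>i<length es. vs ! i \<in> es ! i \<and> vs ! Suc i \<in> es ! i"
  then show "length (rev vs) = Suc (length (rev es))" by simp
  fix i assume i: "i < length (rev es)"
  let ?j = "length es - Suc i"
  have "rev es ! i = es ! ?j" "rev vs ! i = vs ! Suc ?j" "rev vs ! Suc i = vs ! ?j"
    using i len by (auto simp: rev_nth Suc_diff_Suc)
  moreover have "?j < length es" using i by simp
  ultimately show "rev vs ! i \<in> rev es ! i" "rev vs ! Suc i \<in> rev es ! i"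
    using inc by auto
qed

lemma bpath_take: "bpath vs es \<Longrightarrow> k \<le> length es \<Longrightarrow> bpath (take (Suc k) vs) (take k es)"
  by (auto simp: bpath_def)

lemma bpath_drop: "bpath vs es \<Longrightarrow> k \<le> length es \<Longrightarrow> bpath (drop k vs) (drop k es)"
  by (auto simp: bpath_def)

lemma bpath_segment:
  assumes "\<And>j. x j \<in> y j \<and> x (Suc j) \<in> y j" "a \<le> b"
  shows "bpath (map x [a..<Suc b]) (map y [a..<b])"
  using assms by (auto simp: bpath_def simp del: upt_Suc)

definition linked :: "'a set \<Rightarrow> 'a set set \<Rightarrow> ('a \<times> 'a) set" where
  "linked A B = {(p, q). p \<in> A \<and> q \<in> A \<and> (\<exists>e\<in>B. p \<in> e \<and> q \<in> e)}"

lemma sym_linked: "sym (linked A B)"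
  by (auto simp: linked_def sym_def)

lemma linked_rtrancl_bpath:
  assumes "(p, q) \<in> (linked A B)\<^sup>*" "p \<in> A"
  shows "\<exists>vs es. bpath vs es \<and> set vs \<subseteq> A \<and> set es \<subseteq> B \<and> hd vs = p \<and> last vs = q"
  using assms
proof (induction rule: rtrancl_induct)
  case base
  then show ?case by (intro exI[of _ "[p]"] exI[of _ "[]"]) auto
next
  case (step q r)
  then obtain vs es where P: "bpath vs es" "set vs \<subseteq> A" "set es \<subseteq> B" "hd vs = p" "last vs = q"
    by blast
  obtain e where "e \<in> B" "q \<in> e" "r \<in> e" "r \<in> A"
    using step by (auto simp: linked_def)
  then show ?case using P bpath_join[of vs es "[r]" "[]" e]
    by (intro exI[of _ "vs @ [r]"] exI[of _ "es @ [e]"]) (auto simp: bpath_not_Nil)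
qed

lemma last_take_Suc: "i < length vs \<Longrightarrow> last (take (Suc i) vs) = vs ! i"
  by (simp add: take_Suc_conv_app_nth)

text \<open>A walk from \<open>Q\<close> to \<open>Q'\<close> with as few vertices as possible: a
  return to \<open>Q\<close> or an early arrival in \<open>Q'\<close> could be cut off. That only
  the first vertex is in \<open>Q\<close> and only the last in \<open>Q'\<close> later keeps the
  edges chosen for attaching the path off the path itself.\<close>

lemma shortest_bpath:
  assumes "p \<in> Q" "q \<in> Q'" "p \<in> A" "(p, q) \<in> (linked A B)\<^sup>*"
  obtains vs es where "bpath vs es" "distinct vs" "distinct es" "set vs \<subseteq> A" "set es \<subseteq> B"
    "hd vs \<in> Q" "last vs \<in> Q'"
    "\<And>i. 0 < i \<Longrightarrow> i < length vs \<Longrightarrow> vs ! i \<notin> Q"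
    "\<And>i. i < length es \<Longrightarrow> vs ! i \<notin> Q'"
proof -
  define good where "good = (\<lambda>(vs, es). bpath vs es \<and> set vs \<subseteq> A \<and> set es \<subseteq> B \<and> hd vs \<in> Q \<and> last vs \<in> Q')"
  have "\<exists>z. good z"
    using linked_rtrancl_bpath[OF assms(4,3)] assms unfolding good_def by fastforce
  then obtain z where z: "good z" "\<And>w. good w \<Longrightarrow> length (fst z) \<le> length (fst w)"
    using ex_has_least_nat[of good _ "\<lambda>w. length (fst w)"] by blast
  obtain vs es where zz: "z = (vs, es)" by force
  have P: "bpath vs es" "set vs \<subseteq> A" "set es \<subseteq> B" "hd vs \<in> Q" "last vs \<in> Q'"
    using z(1) by (auto simp: good_def zz)
  have min: "length vs \<le> length vs'"
    if "bpath vs' es'" "set vs' \<subseteq> A" "set es' \<subseteq> B" "hd vs' \<in> Q" "last vs' \<in> Q'" for vs' es'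
    using z(2)[of "(vs', es')"] that by (simp add: good_def zz)
  have len: "length vs = Suc (length es)" using P by (simp add: bpath_def)
  have noQ: "vs ! i \<notin> Q" if i: "0 < i" "i < length vs" for i
  proof
    assume "vs ! i \<in> Q"
    then have "length vs \<le> length (drop i vs)"
      using i len P bpath_drop[OF P(1), of i]
      by (intro min[of "drop i vs" "drop i es"])
        (auto simp: hd_drop_conv_nth dest: in_set_dropD)
    then show False using i by simp
  qed
  have noQ': "vs ! i \<notin> Q'" if i: "i < length es" for i
  proof
    assume "vs ! i \<in> Q'"
    then have "length vs \<le> length (take (Suc i) vs)"
      using i len P bpath_take[OF P(1), of i]
      by (intro min[of "take (Suc i) vs" "take i es"])
        (auto simp: last_take_Suc hd_take dest: in_set_takeD)
    then show False using i len by simp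
  qed
  text \<open>Two vertices of a common edge are consecutive, else the path could be shortened.\<close>
  have short: False if ij: "i < j" "Suc i < j" "j < length vs" and e: "e \<in> B" "vs ! i \<in> e" "vs ! j \<in> e" for i j e
  proof -
    let ?vs = "take (Suc i) vs @ drop j vs" and ?es = "take i es @ e # drop j es"
    have "bpath ?vs ?es"
      using ij e len bpath_take[OF P(1), of i] bpath_drop[OF P(1), of j]
      by (intro bpath_join) (auto simp: last_take_Suc hd_drop_conv_nth)
    moreover have "hd ?vs = hd vs" using len by (cases vs) auto
    moreover have "last ?vs = last vs" using ij by (auto simp: last_append)
    ultimately have "length vs \<le> length ?vs"
      using P e by (intro min[of ?vs ?es]) (auto dest: in_set_takeD in_set_dropD)
    then show False using ij by auto
  qed
  have "distinct es"
    unfolding distinct_conv_nth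
  proof (intro allI impI)
    fix i j assume ij: "i < length es" "j < length es" "i \<noteq> j"
    \<comment> \<open>An edge used at positions \<open>i\<close> and \<open>j\<close> contains the
      vertices at \<open>i\<close> and \<open>Suc j\<close>, which are not consecutive.\<close>
    have "es ! i \<noteq> es ! j" if "i < j" "j < length es" for i j
      using short[of i "Suc j" "es ! i"] that P len by (force simp: bpath_def)
    then show "es ! i \<noteq> es ! j" using ij by (metis linorder_neqE_nat)
  qed
  moreover have "distinct vs"
    unfolding distinct_conv_nth
  proof (intro allI impI)
    fix i j assume ij: "i < length vs" "j < length vs" "i \<noteq> j"
    have "vs ! i \<noteq> vs ! j" if ij: "i < j" "j < length vs" for i j
    proof
      assume eq: "vs ! i = vs ! j"
      \<comment> \<open>The edge leaving position \<open>j\<close> would be a shortcut from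
        \<open>i\<close> to \<open>Suc j\<close>; if there is no such edge, \<open>vs ! i\<close> is
        an early arrival in \<open>Q'\<close>.\<close>
      show False
      proof (cases "j < length es")
        case True
        then have "es ! j \<in> B" using P nth_mem by blast
          then show False using True short[of i "Suc j" "es ! j"] ij P len eq by (auto simp: bpath_def)
      next
        case False
        then have "vs ! j = last vs" using ij len by (auto simp: last_conv_nth bpath_not_Nil[OF P(1)]
              intro!: arg_cong[where f = "(!) vs"])
        then show False using noQ'[of i] ij len eq P False by auto
      qed
    qed
    then show "vs ! i \<noteq> vs ! j" using ij by (metis linorder_neqE_nat)
  qed
  ultimately show thesis using that P noQ noQ' by blast
qed

section \<open>Crossing paths in a longest cycle\<close>

locale dirac_hypergraph =
  fixes V :: "'a set" and E :: "'a set set" and \<delta> :: nat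
  assumes finite_V: "finite V"
    and E_Pow: "E \<subseteq> Pow V"
    and V_nonempty: "V \<noteq> {}"
    and card_V: "card V \<le> \<delta>"
    and card_E: "card E + 10 \<le> 4 * \<delta>"
    and degree: "v \<in> V \<Longrightarrow> \<delta> \<le> card {e \<in> E. v \<in> e}"
    and cut: "\<lbrakk>SX \<subseteq> V; SY \<subseteq> E; RX \<subseteq> V; RY \<subseteq> E; card SX + card SY \<le> 2;
      RX \<inter> SX = {}; RY \<inter> SY = {}; RX \<noteq> {} \<or> RY \<noteq> {};
      \<And>v e. v \<in> RX \<Longrightarrow> e \<in> E \<Longrightarrow> v \<in> e \<Longrightarrow> e \<in> RY \<union> SY;
      \<And>v e. e \<in> RY \<Longrightarrow> v \<in> e \<Longrightarrow> v \<in> RX \<union> SX\<rbrakk>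
      \<Longrightarrow> V \<subseteq> RX \<union> SX \<and> E \<subseteq> RY \<union> SY"
begin

lemma finite_E: "finite E"
  using finite_V E_Pow finite_subset by blast

text \<open>The degree of one vertex is at most the number of edges, so 10 is at most three times
  \<delta>.\<close>

lemma \<delta>_ge_4: "4 \<le> \<delta>"
proof -
  obtain v where "v \<in> V" using V_nonempty by blast
  moreover have "card {e \<in> E. v \<in> e} \<le> card E" by (intro card_mono finite_E) auto
  ultimately show ?thesis using degree[of v] card_E by linarith
qed

text \<open>The vertices of an edge separate it, as a vertex of the incidence graph, from all other
  edges. If there were at most two of them, no other edge could exist.\<close>

lemma card_edge: assumes "e \<in> E" shows "3 \<le> card e"
proof (rule ccontr)
  assume "\<not> 3 \<le> card e"
  then have "E \<subseteq> {e}"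
    using cut[of e "{}" "{}" "{e}"] assms E_Pow by auto
  then have "card E \<le> 1" using card_mono[of "{e}" E] by simp
  moreover obtain v where "v \<in> V" using V_nonempty by blast
  moreover have "card {e \<in> E. v \<in> e} \<le> card E" by (intro card_mono finite_E) auto
  ultimately show False using degree[of v] \<delta>_ge_4 by linarith
qed

definition path :: "'a list \<Rightarrow> 'a set list \<Rightarrow> bool" where
  "path vs es \<longleftrightarrow> bpath vs es \<and> distinct vs \<and> distinct es \<and> set vs \<subseteq> V \<and> set es \<subseteq> E"

definition cycle :: "'a list \<Rightarrow> 'a set list \<Rightarrow> bool" where
  "cycle vs es \<longleftrightarrow> vs \<noteq> [] \<and> distinct vs \<and> distinct es \<and> set vs \<subseteq> V \<and> set es \<subseteq> E \<and>
     bpath (vs @ [hd vs]) es"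

lemma cycle_close:
  assumes "path vs es" "e \<in> E" "e \<notin> set es" "hd vs \<in> e" "last vs \<in> e"
  shows "cycle vs (es @ [e])"
proof -
  have "vs \<noteq> []" using assms by (auto simp: path_def bpath_def)
  then show ?thesis
    using assms bpath_join[of vs es "[hd vs]" "[]" e] by (auto simp: path_def cycle_def)
qed

lemma path_rev: "path vs es \<Longrightarrow> path (rev vs) (rev es)"
  by (simp add: path_def bpath_rev)

lemma path_join:
  assumes "path vs es" "path vs' es'" "e \<in> E" "last vs \<in> e" "hd vs' \<in> e"
    and "set vs \<inter> set vs' = {}" "set es \<inter> set es' = {}" "e \<notin> set es" "e \<notin> set es'"
  shows "path (vs @ vs') (es @ e # es')"
  using assms bpath_join[of vs es vs' es' e] by (auto simp: path_def)

lemma path_take: "path vs es \<Longrightarrow> k \<le> length es \<Longrightarrow> path (take (Suc k) vs) (take k es)"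
  unfolding path_def using bpath_take[of vs es k] by (auto dest: in_set_takeD)

lemma path_drop: "path vs es \<Longrightarrow> k \<le> length es \<Longrightarrow> path (drop k vs) (drop k es)"
  unfolding path_def using bpath_drop[of vs es k] by (auto dest: in_set_dropD)

lemma path_single: "v \<in> V \<Longrightarrow> path [v] []"
  by (simp add: path_def)

lemma cycle_length: "cycle vs es \<Longrightarrow> length vs = length es"
  by (auto simp: cycle_def bpath_def)

lemma cycle_berge: "cycle vs es \<Longrightarrow> berge_cycle V E (length vs) vs es"
proof -
  assume C: "cycle vs es"
  have "vs ! i \<in> es ! i \<and> vs ! (Suc i mod length vs) \<in> es ! i" if "i < length vs" for i
  proof (cases "Suc i = length vs")
    case True
    then show ?thesis using C that cycle_length[OF C]
      by (auto simp: cycle_def bpath_def nth_append hd_conv_nth dest!: spec[of _ i])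
  next
    case False
    then show ?thesis using C that cycle_length[OF C]
      by (auto simp: cycle_def bpath_def nth_append dest!: spec[of _ i])
  qed
  then show ?thesis using C cycle_length[OF C] by (auto simp: cycle_def berge_cycle_def)
qed

text \<open>Deleting the edge \<open>e\<close> removes one vertex of the incidence graph and leaves
  it connected. So two vertices of \<open>e\<close> are joined by a path that avoids
  \<open>e\<close>, and \<open>e\<close> closes it.\<close>

lemma cycle_ex: "\<exists>vs es. cycle vs es \<and> 2 \<le> length vs"
proof -
  obtain v where v: "v \<in> V" using V_nonempty by blast
  then have "{e \<in> E. v \<in> e} \<noteq> {}" using degree[of v] \<delta>_ge_4 by force
  then obtain e where e: "e \<in> E" "v \<in> e" by blast
  then have "card (e - {v}) \<ge> 2" using card_edge[of e] E_Pow finite_V by (simp add: card_Diff_singleton)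
  then have "e - {v} \<noteq> {}" by force
  then obtain w where w: "w \<in> e" "w \<noteq> v" by blast
  let ?B = "E - {e}"
  let ?RX = "{p. (v, p) \<in> (linked V ?B)\<^sup>*}"
  let ?RY = "{f \<in> ?B. f \<inter> ?RX \<noteq> {}}"
  have step: "q \<in> ?RX" if "p \<in> ?RX" "f \<in> ?B" "p \<in> f" "q \<in> f" for p q f
  proof -
    have "(p, q) \<in> linked V ?B" using that E_Pow by (auto simp: linked_def)
    then show ?thesis using that by (auto intro: rtrancl_into_rtrancl)
  qed
  have RV: "?RX \<subseteq> V"
    using v by (auto simp: linked_def elim: rtranclE)
  have "V \<subseteq> ?RX \<union> {}"
  proof (rule conjunct1[OF cut[of "{}" "{e}" ?RX ?RY]])
    show "?RX \<noteq> {} \<or> ?RY \<noteq> {}" by blast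
    show "f \<in> ?RY \<union> {e}" if "p \<in> ?RX" "f \<in> E" "p \<in> f" for p f using that by blast
    show "q \<in> ?RX \<union> {}" if "f \<in> ?RY" "q \<in> f" for q f using that step by blast
  qed (use e RV in auto)
  then have "(v, w) \<in> (linked V ?B)\<^sup>*" using w e E_Pow by blast
  then obtain vs es where
    P: "bpath vs es" "distinct vs" "distinct es" "set vs \<subseteq> V" "set es \<subseteq> ?B" "hd vs \<in> {v}" "last vs \<in> {w}"
    using shortest_bpath[of v "{v}" w "{w}" V ?B] v by blast
  then have "cycle vs (es @ [e])"
    using e w by (intro cycle_close) (auto simp: path_def)
  moreover have "length vs \<noteq> 1" using P w by (auto simp: length_Suc_conv)
  moreover have "vs \<noteq> []" using P by (simp add: bpath_not_Nil)
  ultimately show ?thesis by (metis One_nat_def less_2_cases_iff length_0_conv not_le)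
qed

definition dg :: "'a set set \<Rightarrow> 'a \<Rightarrow> nat" where
  "dg Z v = card {e \<in> Z. v \<in> e}"

definition outer :: "'a set set \<Rightarrow> 'a \<Rightarrow> 'a set set" where
  "outer Z v = {e \<in> E - Z. v \<in> e}"

lemma card_outer:
  assumes "v \<in> V" "Z \<subseteq> E" shows "\<delta> \<le> card (outer Z v) + dg Z v"
proof -
  have "{e \<in> E. v \<in> e} = outer Z v \<union> {e \<in> Z. v \<in> e}" using assms by (auto simp: outer_def)
  then have "card {e \<in> E. v \<in> e} \<le> card (outer Z v) + card {e \<in> Z. v \<in> e}"
    by (metis card_Un_le)
  then show ?thesis using degree[OF assms(1)] by (simp add: dg_def)
qed

text \<open>The double count behind every contradiction: \<open>Z\<close> is the edge set of a path
  or cycle, the neighbourhoods of \<open>F\<close> off \<open>Z\<close> are disjoint blocks, and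
  \<open>H\<close> is one more block, later the edges of a component.\<close>

lemma outer_count:
  assumes F: "F \<subseteq> V" and Z: "Z \<subseteq> E" and H: "H \<subseteq> E - Z"
    and disj: "\<And>u v. u \<in> F \<Longrightarrow> v \<in> F \<Longrightarrow> u \<noteq> v \<Longrightarrow> outer Z u \<inter> outer Z v = {}"
    and disjH: "\<And>u. u \<in> F \<Longrightarrow> outer Z u \<inter> H = {}"
  shows "card F * \<delta> + card H + card Z \<le> card E + (\<Sum>v\<in>F. dg Z v)"
proof -
  have finF: "finite F" using F finite_V finite_subset by blast
  have fin: "finite Z" "finite H" "\<And>v. finite (outer Z v)"
    using Z H finite_E by (auto intro: finite_subset simp: outer_def)
  have "card F * \<delta> = (\<Sum>v\<in>F. \<delta>)" by simp
  also have "\<dots> \<le> (\<Sum>v\<in>F. card (outer Z v) + dg Z v)"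
    using F Z by (intro sum_mono card_outer) auto
  also have "\<dots> = card (\<Union>v\<in>F. outer Z v) + (\<Sum>v\<in>F. dg Z v)"
    using finF fin disj by (simp add: sum.distrib card_UN_disjoint)
  finally have "card F * \<delta> \<le> card (\<Union>v\<in>F. outer Z v) + (\<Sum>v\<in>F. dg Z v)" .
  moreover have "card (\<Union>v\<in>F. outer Z v) + card H + card Z = card ((\<Union>v\<in>F. outer Z v) \<union> H \<union> Z)"
  proof -
    have "card ((\<Union>v\<in>F. outer Z v) \<union> H) = card (\<Union>v\<in>F. outer Z v) + card H"
      using finF fin disjH by (intro card_Un_disjoint) auto
    moreover have "card ((\<Union>v\<in>F. outer Z v) \<union> H \<union> Z) = card ((\<Union>v\<in>F. outer Z v) \<union> H) + card Z"
      using finF fin H by (intro card_Un_disjoint) (auto simp: outer_def)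
    ultimately show ?thesis by simp
  qed
  moreover have "card ((\<Union>v\<in>F. outer Z v) \<union> H \<union> Z) \<le> card E"
    using Z H by (intro card_mono finite_E) (auto simp: outer_def)
  ultimately show ?thesis by linarith
qed

end

section \<open>Paths with more vertices than a longest cycle\<close>

locale longest_cycle = dirac_hypergraph +
  fixes c :: nat
  assumes c_ge_2: "2 \<le> c"
    and c_less: "c < card V"
    and c_max: "cycle vs es \<Longrightarrow> length vs \<le> c"
begin

lemma c_less_\<delta>: "c < \<delta>"
  using c_less card_V by linarith

lemma path_ends_disjoint:
  assumes P: "path vs es" "c < length vs"
  shows "outer (set es) (hd vs) \<inter> outer (set es) (last vs) = {}"
  using cycle_close[OF P(1)] c_max P(2) by (fastforce simp: outer_def)

text \<open>Run from the head to position \<open>s\<close>, jump by \<open>es ! s\<close> to the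
  last vertex and walk back to position \<open>Suc t\<close>. The vertices at positions
  \<open>Suc s\<close> to \<open>t\<close> are dropped. The edge \<open>es ! t\<close> becomes free
  and contains both ends of the new path, so it can close it.\<close>

lemma path_crossing_path:
  assumes P: "path vs es" and s: "s < t" "t < length es" "last vs \<in> es ! s" "hd vs \<in> es ! t"
  defines "vs' \<equiv> take (Suc s) vs @ rev (drop (Suc t) vs)"
    and "es' \<equiv> take s es @ es ! s # rev (drop (Suc t) es)"
  shows "path vs' es'" "hd vs' = hd vs" "last vs' = vs ! Suc t" "last vs' \<in> es ! t"
    "es ! t \<in> E - set es'"
proof -
  have len: "length vs = Suc (length es)" using P by (simp add: path_def bpath_def)
  have d: "distinct vs" "distinct es" using P by (auto simp: path_def)
  have dv: "set (take (Suc s) vs) \<inter> set (drop (Suc t) vs) = {}"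
    using d s by (intro set_take_disj_set_drop_if_distinct) auto
  have de: "set (take (Suc s) es) \<inter> set (drop t es) = {}"
    using d s by (intro set_take_disj_set_drop_if_distinct) auto
  have tk: "take (Suc s) es = take s es @ [es ! s]" using s by (simp add: take_Suc_conv_app_nth)
  have dr: "drop t es = es ! t # drop (Suc t) es" using s by (simp add: Cons_nth_drop_Suc)
  have dt: "es ! s \<notin> set (take s es)" "es ! t \<notin> set (drop (Suc t) es)"
    using d distinct_take[of es "Suc s"] distinct_drop[of es t] unfolding tk dr by auto
  show "path vs' es'"
    unfolding vs'_def es'_def
  proof (rule path_join)
    show "path (take (Suc s) vs) (take s es)" using P s by (intro path_take) auto
    show "path (rev (drop (Suc t) vs)) (rev (drop (Suc t) es))" using P s by (intro path_rev path_drop) auto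
    show "es ! s \<in> E" using P s by (auto simp: path_def)
    show "last (take (Suc s) vs) \<in> es ! s"
      using P s len by (auto simp: last_take_Suc path_def bpath_def)
    show "hd (rev (drop (Suc t) vs)) \<in> es ! s" using s len by (simp add: hd_rev last_drop)
  qed (use dv de dt in \<open>auto simp: tk dr\<close>)
  show "last vs' = vs ! Suc t"
    using s len by (auto simp: vs'_def last_append last_rev hd_drop_conv_nth)
  then show "last vs' \<in> es ! t" using P s by (auto simp: path_def bpath_def)
  show "hd vs' = hd vs" using len by (cases vs) (auto simp: vs'_def)
  have "es ! t \<in> E" using P s by (auto simp: path_def)
  moreover have "es ! t \<noteq> es ! s" "es ! t \<notin> set (take s es)" "es ! t \<notin> set (drop (Suc t) es)"
    using de dt by (auto simp: tk dr)
  ultimately show "es ! t \<in> E - set es'" by (simp add: es'_def)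
qed

lemma path_crossing:
  assumes "path vs es" "s < t" "t < length es" "last vs \<in> es ! s" "hd vs \<in> es ! t"
  shows "cycle (take (Suc s) vs @ rev (drop (Suc t) vs))
    ((take s es @ es ! s # rev (drop (Suc t) es)) @ [es ! t])"
  using path_crossing_path[OF assms] assms by (intro cycle_close) auto

lemma path_crossing_length:
  assumes "path vs es" "s < t" "t < length es" "last vs \<in> es ! s" "hd vs \<in> es ! t"
  shows "length vs \<le> c + (t - s)"
proof -
  have "length vs = Suc (length es)" using assms by (simp add: path_def bpath_def)
  then show ?thesis using c_max[OF path_crossing[OF assms]] assms by simp
qed

text \<open>The interior vertices that can be left out when the path is closed to a cycle by crossing
  edges from its two ends.\<close>

definition lost :: "'a list \<Rightarrow> 'a set list \<Rightarrow> 'a set" where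
  "lost vs es = {vs ! Suc s | s. Suc s < length es \<and> last vs \<in> es ! s \<and> hd vs \<in> es ! Suc s}"

text \<open>A crossing at consecutive positions drops a single vertex and still uses every edge. For
  a path with \<open>c + 1\<close> vertices the result is again a longest cycle.\<close>

lemma lost_cycle:
  assumes P: "path vs es" and w: "w \<in> lost vs es"
  shows "\<exists>vs' es'. cycle vs' es' \<and> Suc (length vs') = length vs \<and> w \<notin> set vs' \<and> set es' = set es"
proof -
  obtain s where s: "w = vs ! Suc s" "Suc s < length es" "last vs \<in> es ! s" "hd vs \<in> es ! Suc s"
    using w by (auto simp: lost_def)
  have len: "length vs = Suc (length es)" using P by (simp add: path_def bpath_def)
  have dist: "distinct vs" using P by (simp add: path_def)
  have "es = take s es @ es ! s # es ! Suc s # drop (Suc (Suc s)) es"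
    using s by (metis Cons_nth_drop_Suc Suc_lessD append_take_drop_id)
  then have "set es = set ((take s es @ es ! s # rev (drop (Suc (Suc s)) es)) @ [es ! Suc s])"
    by (metis (no_types, lifting) Un_insert_right insert_commute list.simps(15) set_append set_rev
        list.set(1) sup_bot_right)
  moreover have "w \<notin> set (take (Suc s) vs @ rev (drop (Suc (Suc s)) vs))"
  proof -
    have "vs = take (Suc s) vs @ w # drop (Suc (Suc s)) vs"
      using s len by (metis Cons_nth_drop_Suc append_take_drop_id less_SucI)
    then show ?thesis using dist by (metis distinct_append distinct.simps(2) not_distinct_conv_prefix Un_iff set_append set_rev disjoint_insert(1) list.set_intros(1) IntI empty_iff)
  qed
  ultimately show ?thesis
    using path_crossing[OF P, of s "Suc s"] s len
    by (intro exI[of _ "take (Suc s) vs @ rev (drop (Suc (Suc s)) vs)"]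
        exI[of _ "(take s es @ es ! s # rev (drop (Suc (Suc s)) es)) @ [es ! Suc s]"] conjI) simp_all
qed

lemma lost_rev:
  assumes "length vs = Suc (length es)"
  shows "lost (rev vs) (rev es) = lost vs es"
proof -
  have sub: "lost (rev vs) (rev es) \<subseteq> lost vs es"
    if len: "length vs = Suc (length es)" for vs :: "'a list" and es
  proof
    fix w assume "w \<in> lost (rev vs) (rev es)"
    then obtain s where s: "w = rev vs ! Suc s" "Suc s < length es"
      "last (rev vs) \<in> rev es ! s" "hd (rev vs) \<in> rev es ! Suc s"
      by (auto simp: lost_def)
    define t where "t = length es - 2 - s"
    have "rev vs ! Suc s = vs ! Suc t" "rev es ! s = es ! Suc t" "rev es ! Suc s = es ! t" "Suc t < length es"
      using s len by (auto simp: t_def rev_nth intro!: arg_cong[where f = "(!) _"])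
    then show "w \<in> lost vs es" using s by (auto simp: lost_def hd_rev last_rev)
  qed
  show ?thesis using sub[of vs es] sub[of "rev vs" "rev es"] assms by auto
qed

text \<open>The edge freed by the crossing also contains the dropped vertex, so it can prolong the
  crossing path to \<open>w\<close> instead of closing it. This gives a path with the same vertices
  and edges that ends in \<open>w\<close>.\<close>

lemma lost_hd_disjoint:
  assumes P: "path vs es" "c < length vs" and w: "w \<in> lost vs es"
  shows "outer (set es) w \<inter> outer (set es) (hd vs) = {}"
proof -
  obtain s where s: "w = vs ! Suc s" "Suc s < length es" "last vs \<in> es ! s" "hd vs \<in> es ! Suc s"
    using w by (auto simp: lost_def)
  have len: "length vs = Suc (length es)" using P by (simp add: path_def bpath_def)
  let ?vs = "take (Suc s) vs @ rev (drop (Suc (Suc s)) vs)"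
  let ?es = "take s es @ es ! s # rev (drop (Suc (Suc s)) es)"
  note C = path_crossing_path[OF P(1) _ s(2-4), simplified]
  have eqv: "vs = take (Suc s) vs @ w # drop (Suc (Suc s)) vs"
    using s len by (metis Cons_nth_drop_Suc append_take_drop_id less_SucI)
  have eqe: "es = take s es @ es ! s # es ! Suc s # drop (Suc (Suc s)) es"
    using s by (metis Cons_nth_drop_Suc Suc_lessD append_take_drop_id)
  have "distinct (take (Suc s) vs @ w # drop (Suc (Suc s)) vs)"
    using P eqv by (metis path_def)
  then have wn: "w \<notin> set ?vs" by auto
  have "path (?vs @ [w]) (?es @ es ! Suc s # [])"
  proof (rule path_join[OF C(1)])
    show "path [w] []" using P s len by (intro path_single) (auto simp: path_def)
    show "hd [w] \<in> es ! Suc s" using P s by (auto simp: path_def bpath_def)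
    show "last ?vs \<in> es ! Suc s" using C(4) by auto
  qed (use wn C in auto)
  moreover have "length (?vs @ [w]) = length vs" using s len by simp
  moreover have "hd (?vs @ [w]) = hd vs" using C(2) len by (cases vs) auto
  moreover have "set (?es @ es ! Suc s # []) = set es"
    using arg_cong[OF eqe, of set] by auto
  ultimately show ?thesis
    using path_ends_disjoint[of "?vs @ [w]" "?es @ es ! Suc s # []"] P(2) by (metis Int_commute last_snoc)
qed

lemma lost_last_disjoint:
  assumes P: "path vs es" "c < length vs" and w: "w \<in> lost vs es"
  shows "outer (set es) w \<inter> outer (set es) (last vs) = {}"
  using lost_hd_disjoint[OF path_rev[OF P(1)], of w] P w lost_rev[of vs es]
  by (simp add: hd_rev path_def bpath_def)

text \<open>Walk from the earlier lost vertex back to the head, jump by \<open>es ! Suc s\<close> to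
  the segment between the two lost vertices, traverse it, jump by \<open>es ! t\<close> to the last
  vertex and walk back to the later lost vertex. All vertices and edges of the path are used, so its
  ends have no common edge outside it.\<close>

lemma lost_disjoint:
  assumes P: "path vs es" "c < length vs" and w: "w \<in> lost vs es" "w' \<in> lost vs es" "w \<noteq> w'"
  shows "outer (set es) w \<inter> outer (set es) w' = {}"
proof -
  have len: "length vs = Suc (length es)" using P by (simp add: path_def bpath_def)
  have d: "distinct vs" "distinct es" using P by (auto simp: path_def)
  have main: "outer (set es) (vs ! Suc s) \<inter> outer (set es) (vs ! Suc t) = {}"
    if st: "s < t" "Suc t < length es" and s: "hd vs \<in> es ! Suc s" and t: "last vs \<in> es ! t" for s t
  proof -
    let ?L = "rev (take (Suc (Suc s)) vs)" and ?LE = "rev (take (Suc s) es)"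
    let ?R = "rev (drop (Suc t) vs)" and ?RE = "rev (drop (Suc t) es)"
    have L: "path ?L ?LE" using P st by (intro path_rev path_take) auto
    have R: "path ?R ?RE" using P st by (intro path_rev path_drop) auto
    have Lh: "hd ?L = vs ! Suc s" "last ?L = hd vs"
      using st len by (auto simp: hd_rev last_rev last_take_Suc hd_take)
    have Rh: "hd ?R = last vs" "last ?R = vs ! Suc t"
      using st len by (auto simp: hd_rev last_rev last_drop hd_drop_conv_nth)
    have inE: "es ! Suc s \<in> E" "es ! t \<in> E" using P st by (auto simp: path_def)
    show ?thesis
    \<comment> \<open>If the lost vertices are adjacent on the path, the middle segment is empty and
      one edge makes the jump from head to last vertex.\<close>
    proof (cases "t = Suc s")
      case True
      have eqe: "es = take (Suc s) es @ es ! t # drop (Suc t) es"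
        using st True by (metis Cons_nth_drop_Suc Suc_lessD append_take_drop_id)
      have de: "distinct (take (Suc s) es @ es ! t # drop (Suc t) es)" using d eqe by metis
      have dv: "set (take (Suc (Suc s)) vs) \<inter> set (drop (Suc t) vs) = {}"
        using d True by (intro set_take_disj_set_drop_if_distinct) auto
      have "path (?L @ ?R) (?LE @ es ! t # ?RE)"
        by (rule path_join[OF L R]) (use Lh Rh s t True inE de dv in auto)
      moreover have "length (?L @ ?R) = length vs" using st len True by simp
      moreover have "set (?LE @ es ! t # ?RE) = set es" using arg_cong[OF eqe, of set] by auto
      moreover have "hd (?L @ ?R) = vs ! Suc s" "last (?L @ ?R) = vs ! Suc t"
        using Lh Rh st len by (auto simp: hd_append last_append)
      ultimately show ?thesis using path_ends_disjoint[of "?L @ ?R"] P by metis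
    next
      case False
      define i where "i = Suc (Suc s)"
      have i: "i \<le> t" using False st by (simp add: i_def)
      let ?M = "take (Suc (t - i)) (drop i vs)" and ?ME = "take (t - i) (drop i es)"
      have M: "path ?M ?ME" using P st i by (intro path_take path_drop) auto
      have Mh: "hd ?M = vs ! i" "last ?M = vs ! t"
        using i st len by (auto simp: hd_take hd_drop_conv_nth last_take_Suc)
      have "drop i es = ?ME @ drop t es" using i by (metis add_diff_inverse_nat append_take_drop_id drop_drop leD add.commute)
      then have eqe: "es = take (Suc s) es @ es ! Suc s # ?ME @ es ! t # drop (Suc t) es"
        using st by (metis Cons_nth_drop_Suc Suc_lessD Suc_lessI append_take_drop_id i_def less_trans_Suc False)
      have eqv: "vs = take (Suc (Suc s)) vs @ ?M @ drop (Suc t) vs"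
      proof -
        have "drop i vs = ?M @ drop (Suc t) vs"
          using i by (metis Suc_diff_le add_diff_inverse_nat append_take_drop_id drop_drop leD le_SucI add.commute)
        then show ?thesis unfolding i_def by (metis append_take_drop_id)
      qed
      have de: "distinct (take (Suc s) es @ es ! Suc s # ?ME @ es ! t # drop (Suc t) es)" using d eqe by metis
      have dv: "distinct (take (Suc (Suc s)) vs @ ?M @ drop (Suc t) vs)" using d eqv by metis
      have MR: "path (?M @ ?R) (?ME @ es ! t # ?RE)"
      proof (rule path_join[OF M R])
        show "last ?M \<in> es ! t" using Mh P st by (auto simp: path_def bpath_def)
      qed (use Mh Rh t inE de dv in auto)
      have "path (?L @ ?M @ ?R) (?LE @ es ! Suc s # ?ME @ es ! t # ?RE)"
      proof (rule path_join[OF L MR])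
        show "hd (?M @ ?R) \<in> es ! Suc s" using Mh P st i len
          by (auto simp: path_def bpath_def i_def hd_append)
      qed (use Lh s inE de dv in auto)
      moreover have "length (?L @ ?M @ ?R) = length vs" using st len i by (simp add: i_def)
      moreover have "set (?LE @ es ! Suc s # ?ME @ es ! t # ?RE) = set es" using arg_cong[OF eqe, of set] by auto
      moreover have "hd (?L @ ?M @ ?R) = vs ! Suc s" "last (?L @ ?M @ ?R) = vs ! Suc t"
        using Lh Rh st len by (auto simp: hd_append last_append)
      ultimately show ?thesis using path_ends_disjoint[of "?L @ ?M @ ?R"] P by metis
    qed
  qed
  obtain s where s: "w = vs ! Suc s" "Suc s < length es" "last vs \<in> es ! s" "hd vs \<in> es ! Suc s"
    using w by (auto simp: lost_def)
  obtain t where t: "w' = vs ! Suc t" "Suc t < length es" "last vs \<in> es ! t" "hd vs \<in> es ! Suc t"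
    using w by (auto simp: lost_def)
  consider "s < t" | "t < s" using w s t by (metis linorder_neqE_nat)
  then show ?thesis using main[of s t] main[of t s] s t by cases auto
qed

lemma dg_set_nth:
  assumes "distinct es"
  shows "dg (set es) u = card {s. s < length es \<and> u \<in> es ! s}"
proof -
  have "{e \<in> set es. u \<in> e} = (!) es ` {s. s < length es \<and> u \<in> es ! s}"
    by (auto simp: in_set_conv_nth)
  moreover have "inj_on ((!) es) {s. s < length es \<and> u \<in> es ! s}"
    using assms by (auto simp: inj_on_def nth_eq_iff_index_eq)
  ultimately show ?thesis by (simp add: dg_def card_image)
qed

lemma finite_lost: "finite (lost vs es)"
  by (rule finite_subset[of _ "(\<lambda>s. vs ! Suc s) ` {..<length es}"]) (auto simp: lost_def)

text \<open>Ore's count: shift the positions of the edges at the last vertex by one. A position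
  shared with the head then names a lost vertex, and all positions together lie among
  \<open>length vs\<close> many.\<close>

lemma dg_ends_le:
  assumes P: "path vs es"
  shows "dg (set es) (hd vs) + dg (set es) (last vs) \<le> length vs + card (lost vs es)"
proof -
  define A where "A = {s. s < length es \<and> hd vs \<in> es ! s}"
  define B where "B = {s. s < length es \<and> last vs \<in> es ! s}"
  have len: "length vs = Suc (length es)" and d: "distinct vs" "distinct es"
    using P by (auto simp: path_def bpath_def)
  have fin: "finite A" "finite B" by (auto simp: A_def B_def)
  have "card A + card (Suc ` B) = card (A \<union> Suc ` B) + card (A \<inter> Suc ` B)"
    using fin by (intro card_Un_Int) auto
  moreover have "card (A \<union> Suc ` B) \<le> card {..length es}"
    by (intro card_mono) (auto simp: A_def B_def)
  moreover have "card (A \<inter> Suc ` B) \<le> card (lost vs es)"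
  proof (rule card_inj_on_le[where f = "(!) vs"])
    show "inj_on ((!) vs) (A \<inter> Suc ` B)"
      using d len by (auto simp: inj_on_def nth_eq_iff_index_eq A_def B_def)
    show "(!) vs ` (A \<inter> Suc ` B) \<subseteq> lost vs es" by (auto simp: A_def B_def lost_def)
  qed (rule finite_lost)
  ultimately show ?thesis
    using len by (simp add: dg_set_nth[OF d(2)] card_image A_def[symmetric] B_def[symmetric])
qed

lemma lost_subset: "path vs es \<Longrightarrow> lost vs es \<subseteq> V"
  by (auto simp: lost_def path_def bpath_def)

lemma lost_not_ends:
  assumes "path vs es" shows "hd vs \<notin> lost vs es" "last vs \<notin> lost vs es"
proof -
  have len: "length vs = Suc (length es)" and d: "distinct vs"
    using assms by (auto simp: path_def bpath_def)
  then have ne: "vs \<noteq> []" by auto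
  show "hd vs \<notin> lost vs es" "last vs \<notin> lost vs es"
    using d len by (auto simp: lost_def hd_conv_nth[OF ne] last_conv_nth[OF ne] nth_eq_iff_index_eq)
qed

text \<open>The two ends of a path together with its lost vertices have pairwise disjoint neighbourhoods
  outside the path.\<close>

lemma lost_count:
  assumes P: "path vs es" "c < length vs" "hd vs \<noteq> last vs"
    and small: "\<And>w. w \<in> lost vs es \<Longrightarrow> dg (set es) w \<le> a"
  shows "(card (lost vs es) + 2) * \<delta> + length es
    \<le> card E + (dg (set es) (hd vs) + dg (set es) (last vs)) + card (lost vs es) * a"
proof -
  let ?W = "lost vs es" and ?F = "insert (hd vs) (insert (last vs) (lost vs es))"
  have ne: "vs \<noteq> []" using P by auto
  have d: "distinct es" and subE: "set es \<subseteq> E" using P by (auto simp: path_def)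
  have "card ?F * \<delta> + card ({} :: 'a set set) + card (set es) \<le> card E + (\<Sum>v\<in>?F. dg (set es) v)"
  proof (rule outer_count)
    show "?F \<subseteq> V" using P ne lost_subset[OF P(1)] by (auto simp: path_def)
    fix u v assume "u \<in> ?F" "v \<in> ?F" "u \<noteq> v"
    then show "outer (set es) u \<inter> outer (set es) v = {}"
      using path_ends_disjoint[OF P(1,2)] lost_hd_disjoint[OF P(1,2)] lost_last_disjoint[OF P(1,2)]
        lost_disjoint[OF P(1,2)] by blast
  qed (use subE in auto)
  moreover have "(\<Sum>v\<in>?F. dg (set es) v) = dg (set es) (hd vs) + dg (set es) (last vs) + (\<Sum>v\<in>?W. dg (set es) v)"
    using lost_not_ends[OF P(1)] P(3) finite_lost by simp
  moreover have "(\<Sum>v\<in>?W. dg (set es) v) \<le> card ?W * a"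
    using small sum_bounded_above[of ?W "dg (set es)" a] by simp
  moreover have "card ?F = card ?W + 2" using lost_not_ends[OF P(1)] P(3) finite_lost by simp
  ultimately show ?thesis using distinct_card[OF d] by simp
qed

end

section \<open>Ears of a longest cycle\<close>

lemma hd_map_upt: "a < b \<Longrightarrow> hd (map x [a..<b]) = x a"
  by (simp add: hd_map)

lemma last_map_upt: "a \<le> b \<Longrightarrow> last (map x [a..<Suc b]) = x b"
  by simp

context longest_cycle begin

text \<open>The longest cycle is x 0, y 0, x 1, y 1, ..., indexed with period c.\<close>

definition cyc :: "(nat \<Rightarrow> 'a) \<Rightarrow> (nat \<Rightarrow> 'a set) \<Rightarrow> bool" where
  "cyc x y \<longleftrightarrow> (\<forall>j. x (j + c) = x j \<and> y (j + c) = y j \<and> x j \<in> y j \<and> x (Suc j) \<in> y j) \<and>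
     inj_on x {..<c} \<and> inj_on y {..<c} \<and> range x \<subseteq> V \<and> range y \<subseteq> E"

lemma cycle_cyc:
  assumes C: "cycle vs es" and len: "length vs = c"
  shows "\<exists>x y. cyc x y \<and> range x = set vs \<and> range y = set es"
proof -
  have le: "length es = c" using cycle_length[OF C] len by simp
  let ?x = "\<lambda>j. vs ! (j mod c)" and ?y = "\<lambda>j. es ! (j mod c)"
  have c0: "0 < c" using c_ge_2 by simp
  have inc: "?x j \<in> ?y j \<and> ?x (Suc j) \<in> ?y j" for j
  proof -
    have j: "j mod c < c" using c0 by simp
    have "Suc j mod c = Suc (j mod c) mod c" by (simp add: mod_Suc_eq)
    moreover have "vs ! (j mod c) \<in> es ! (j mod c) \<and> vs ! (Suc (j mod c) mod c) \<in> es ! (j mod c)"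
      using cycle_berge[OF C] j len by (auto simp: berge_cycle_def)
    ultimately show ?thesis by simp
  qed
  have rx: "range ?x = set vs"
  proof -
    have "range ?x \<subseteq> set vs" using c0 len by auto
    moreover have "v \<in> range ?x" if v: "v \<in> set vs" for v
    proof -
      obtain i where i: "i < c" "vs ! i = v" using v len by (auto simp: in_set_conv_nth)
      then show ?thesis by (intro range_eqI[where x = i]) simp
    qed
    ultimately show ?thesis by blast
  qed
  have ry: "range ?y = set es"
  proof -
    have "range ?y \<subseteq> set es" using c0 le by auto
    moreover have "v \<in> range ?y" if v: "v \<in> set es" for v
    proof -
      obtain i where i: "i < c" "es ! i = v" using v le by (auto simp: in_set_conv_nth)
      then show ?thesis by (intro range_eqI[where x = i]) simp
    qed
    ultimately show ?thesis by blast
  qed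
  have "cyc ?x ?y"
    unfolding cyc_def using inc rx ry C len le
    by (auto simp: inj_on_def nth_eq_iff_index_eq cycle_def)
  then show ?thesis using rx ry by blast
qed

text \<open>A path outside the cycle whose ends are joined to x i and x k by the edges f and g; these may
  be the cycle edges following x i and x k.\<close>

definition ear :: "(nat \<Rightarrow> 'a) \<Rightarrow> (nat \<Rightarrow> 'a set) \<Rightarrow> nat \<Rightarrow> nat \<Rightarrow> 'a list \<Rightarrow> 'a set list \<Rightarrow> 'a set \<Rightarrow> 'a set \<Rightarrow> bool" where
  "ear x y i k vs es f g \<longleftrightarrow> path vs es \<and> set vs \<inter> range x = {} \<and> set es \<inter> range y = {} \<and>
     f \<in> E \<and> g \<in> E \<and> f \<noteq> g \<and> f \<notin> set es \<and> g \<notin> set es \<and>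
     (f \<notin> range y \<or> f = y i) \<and> (g \<notin> range y \<or> g = y k) \<and>
     x i \<in> f \<and> hd vs \<in> f \<and> last vs \<in> g \<and> x k \<in> g"

context
  fixes x :: "nat \<Rightarrow> 'a" and y :: "nat \<Rightarrow> 'a set"
  assumes C: "cyc x y"
begin

lemma cyc_inc: "x j \<in> y j" "x (Suc j) \<in> y j"
  using C by (auto simp: cyc_def)

lemma cyc_sub: "range x \<subseteq> V" "range y \<subseteq> E" "x j \<in> V" "y j \<in> E"
  using C by (auto simp: cyc_def)

lemma cyc_period: "x (j + c) = x j" "y (j + c) = y j"
  using C by (auto simp: cyc_def)

lemma cyc_mod: "x (j mod c) = x j \<and> y (j mod c) = y j"
proof (induction j rule: less_induct)
  case (less j)
  show ?case
  proof (cases "j < c")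
    case False
    then have "x ((j - c) mod c) = x (j - c) \<and> y ((j - c) mod c) = y (j - c)"
      using c_ge_2 by (intro less) auto
    then show ?thesis using False cyc_period[of "j - c"] by (simp add: le_mod_geq)
  qed simp
qed

lemma mod_window: "i mod c = j mod c \<Longrightarrow> i < j + c \<Longrightarrow> j < i + c \<Longrightarrow> i = (j::nat)"
proof (induction i j rule: linorder_wlog)
  case (le i j)
  then have "c dvd j - i" by (metis mod_eq_dvd_iff_nat)
  then show ?case using le by (auto dest!: dvd_imp_le)
next
  case (sym i j) then show ?case by simp
qed

lemma cyc_inj:
  assumes "i < j + c" "j < i + c"
  shows "x i = x j \<longleftrightarrow> i = j" "y i = y j \<longleftrightarrow> i = j"
proof -
  have m: "i mod c < c" "j mod c < c" using c_ge_2 by auto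
  have "inj_on x {..<c}" "inj_on y {..<c}" using C by (auto simp: cyc_def)
  then have "x i = x j \<Longrightarrow> i mod c = j mod c" "y i = y j \<Longrightarrow> i mod c = j mod c"
    using m cyc_mod[of i] cyc_mod[of j] by (auto simp: inj_on_def)
  then show "x i = x j \<longleftrightarrow> i = j" "y i = y j \<longleftrightarrow> i = j" using mod_window assms by auto
qed

lemma cyc_window: "\<exists>i\<in>{s..<s + c}. x i = x j \<and> y i = y j"
proof -
  \<comment> \<open>The summand \<open>c * s\<close> vanishes modulo \<open>c\<close> and keeps the
    subtraction of natural numbers exact.\<close>
  define i where "i = s + (j + c * s - s) mod c"
  have c0: "0 < c" using c_ge_2 by simp
  then have "s \<le> c * s" by simp
  then have "i mod c = j mod c"
    unfolding i_def by (metis add.commute add_diff_inverse_nat le_add_diff_inverse2 le_add_same_cancel2 mod_add_right_eq mod_mult_self2 trans_le_add2 add.assoc)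
  then have "x i = x j \<and> y i = y j" by (metis cyc_mod)
  moreover have "i \<in> {s..<s + c}" using c0 by (simp add: i_def)
  ultimately show ?thesis by blast
qed

lemma range_window: "range x = x ` {s..<s + c}" "range y = y ` {s..<s + c}"
  using cyc_window[of s] by (auto simp: image_iff) (metis+)

lemma card_ranges: "card (range x) = c" "card (range y) = c"
proof -
  have "card (x ` {..<c}) = c" "card (y ` {..<c}) = c"
    using C by (auto simp: cyc_def card_image)
  then show "card (range x) = c" "card (range y) = c"
    using range_window[of 0] by (simp_all add: lessThan_atLeast0)
qed

lemma dg_range: "dg (range y) v = card {j \<in> {s..<s + c}. v \<in> y j}"
proof -
  have "{e \<in> range y. v \<in> e} = y ` {j \<in> {s..<s + c}. v \<in> y j}"
    unfolding range_window(2)[of s] by auto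
  moreover have "inj_on y {j \<in> {s..<s + c}. v \<in> y j}"
    by (auto simp: inj_on_def cyc_inj(2))
  ultimately show ?thesis by (simp add: dg_def card_image)
qed

lemma cyc_segment:
  assumes "a \<le> b" "b < a + c"
  shows "path (map x [a..<Suc b]) (map y [a..<b])"
proof -
  have "bpath (map x [a..<Suc b]) (map y [a..<b])"
    using cyc_inc assms by (intro bpath_segment) auto
  moreover have "inj_on x {a..<Suc b}" "inj_on y {a..<b}"
    using assms by (auto simp: inj_on_def cyc_inj)
  ultimately show ?thesis
    using cyc_sub by (auto simp: path_def distinct_map simp del: upt_Suc)
qed

text \<open>The path replaces the interior of the arc from \<open>x i\<close> to \<open>x k\<close>.
  As the cycle cannot grow, it has at most the \<open>k - i - 1\<close> vertices that it
  replaces.\<close>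

lemma detour:
  assumes P: "path vs es" and out: "set vs \<inter> range x = {}" "set es \<inter> range y = {}"
    and ik: "i < k" "k \<le> i + c"
    and fg: "f \<in> E" "g \<in> E" "f \<noteq> g" "f \<notin> set es" "g \<notin> set es"
      "f \<notin> y ` {k..<i + c}" "g \<notin> y ` {k..<i + c}"
    and inc: "x i \<in> f" "hd vs \<in> f" "last vs \<in> g" "x k \<in> g"
  shows "i + length vs < k"
proof -
  let ?vs = "map x [k..<Suc (i + c)]" and ?es = "map y [k..<i + c]"
  have seg: "path ?vs ?es" using ik by (intro cyc_segment) auto
  have ends: "hd ?vs = x k" "last ?vs = x (i + c)"
    using ik by (auto simp: hd_map_upt last_map_upt simp del: upt_Suc)
  have ne: "vs \<noteq> []" using P by (auto simp: path_def bpath_def)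
  have Q: "path (?vs @ vs) (?es @ f # es)"
  proof (rule path_join[OF seg P])
    show "last ?vs \<in> f" using inc cyc_period ends by simp
  qed (use fg inc out in auto)
  have "cycle (?vs @ vs) ((?es @ f # es) @ [g])"
  proof (rule cycle_close[OF Q])
    show "hd (?vs @ vs) \<in> g" using ends inc ik by (auto simp: hd_append)
    show "last (?vs @ vs) \<in> g" using ne inc by simp
  qed (use fg in auto)
  from c_max[OF this] show ?thesis using ik by simp
qed

text \<open>Shifting the second index by \<open>c\<close> moves the complementary arc between the
  two indices, so that statements about one arc transfer to the other.\<close>

lemma ear_rev: "ear x y i k vs es f g \<Longrightarrow> ear x y k (i + c) (rev vs) (rev es) g f"
  by (auto simp: ear_def path_rev cyc_period hd_rev last_rev)

text \<open>Follow the cycle from \<open>x (Suc i)\<close> to \<open>x k\<close>, traverse the ear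
  backwards to \<open>x i\<close>, and follow the cycle backwards to \<open>x (Suc k)\<close>. No
  vertex of cycle or ear is left out. The cycle edges \<open>y i\<close> and \<open>y k\<close> are
  bypassed, which is why an ear may use them as \<open>f\<close> and \<open>g\<close>.\<close>

lemma ear_path:
  assumes ear: "ear x y i k vs es f g" and ik: "i < k" "k < i + c"
  defines "vs' \<equiv> map x [Suc i..<Suc k] @ rev vs @ rev (map x [Suc k..<Suc (i + c)])"
    and "es' \<equiv> map y [Suc i..<k] @ g # rev es @ f # rev (map y [Suc k..<i + c])"
  shows "path vs' es'" "hd vs' = x (Suc i)" "last vs' = x (Suc k)" "length vs' = c + length vs"
    "set es' = y ` {Suc i..<k} \<union> y ` {Suc k..<i + c} \<union> {f, g} \<union> set es"
    "\<And>j. Suc i \<le> j \<Longrightarrow> j < k \<Longrightarrow> es' ! (j - Suc i) = y j" "es' ! (k - Suc i) = g"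
    "\<And>j. Suc i \<le> j \<Longrightarrow> j \<le> k \<Longrightarrow> vs' ! (j - Suc i) = x j"
    "length es' = c + length vs - 1"
proof -
  have P: "path vs es" and out: "set vs \<inter> range x = {}" "set es \<inter> range y = {}"
    and fg: "f \<in> E" "g \<in> E" "f \<noteq> g" "f \<notin> set es" "g \<notin> set es"
      "f \<notin> range y \<or> f = y i" "g \<notin> range y \<or> g = y k"
    and inc: "x i \<in> f" "hd vs \<in> f" "last vs \<in> g" "x k \<in> g"
    using ear by (auto simp: ear_def)
  let ?A = "map x [Suc i..<Suc k]" and ?AE = "map y [Suc i..<k]"
  let ?B = "map x [Suc k..<Suc (i + c)]" and ?BE = "map y [Suc k..<i + c]"
  have A: "path ?A ?AE" and B: "path ?B ?BE" using ik by (simp_all del: upt_Suc add: cyc_segment)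
  have Ae: "hd ?A = x (Suc i)" "last ?A = x k"
    using ik by (auto simp: hd_map_upt last_map_upt simp del: upt_Suc)
  have Be: "hd ?B = x (Suc k)" "last ?B = x i"
    using ik cyc_period(1)[of i] by (auto simp: hd_map_upt last_map_upt simp del: upt_Suc)
  have ne: "vs \<noteq> []" "?A \<noteq> []" "?B \<noteq> []" using P ik by (auto simp: path_def bpath_def)
  have AB: "set ?A \<inter> set ?B = {}" "set ?AE \<inter> set ?BE = {}"
    using ik by (auto simp: cyc_inj)
  have sub: "set ?A \<subseteq> range x" "set ?B \<subseteq> range x" "set ?AE \<subseteq> range y" "set ?BE \<subseteq> range y" by auto
  have yk: "y i = y (i + c)" using cyc_period by simp
  have fy: "f \<notin> set ?AE" "f \<notin> set ?BE" "g \<notin> set ?AE" "g \<notin> set ?BE"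
    using fg(6,7) ik by (auto simp: cyc_inj yk)
  have VB: "path (rev vs @ rev ?B) (rev es @ f # rev ?BE)"
  proof (rule path_join[OF path_rev[OF P] path_rev[OF B]])
    show "last (rev vs) \<in> f" using inc ne by (simp add: last_rev)
    show "hd (rev ?B) \<in> f" using inc Be by (simp only: hd_rev)
    show "set (rev vs) \<inter> set (rev ?B) = {}" "set (rev es) \<inter> set (rev ?BE) = {}"
      using sub out unfolding set_rev by blast+
    show "f \<notin> set (rev es)" "f \<notin> set (rev ?BE)" using fg fy unfolding set_rev by blast+
  qed (fact fg)
  show "path vs' es'"
    unfolding vs'_def es'_def
  proof (rule path_join[OF A VB])
    show "last ?A \<in> g" using inc Ae by simp
    show "hd (rev vs @ rev ?B) \<in> g" using inc ne by (simp add: hd_append hd_rev del: upt_Suc)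
    have "set ?A \<inter> set vs = {}" "set ?AE \<inter> set es = {}" using sub out by blast+
    then show "set ?A \<inter> set (rev vs @ rev ?B) = {}" "set ?AE \<inter> set (rev es @ f # rev ?BE) = {}"
      using AB fy(1) by (simp_all only: set_append set_rev list.set Int_Un_distrib Int_insert_right if_False) simp_all
    show "g \<notin> set ?AE" "g \<notin> set (rev es @ f # rev ?BE)"
      using fg fy unfolding set_append set_rev list.set by blast+
  qed (fact fg)
  show "hd vs' = x (Suc i)" unfolding vs'_def using ne Ae by (simp del: upt_Suc)
  show "last vs' = x (Suc k)" unfolding vs'_def
    using ne Be by (simp add: last_append last_rev del: upt_Suc)
  show "length vs' = c + length vs" unfolding vs'_def using ik by simp
  show "set es' = y ` {Suc i..<k} \<union> y ` {Suc k..<i + c} \<union> {f, g} \<union> set es"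
    unfolding es'_def by auto
  show "es' ! (j - Suc i) = y j" if "Suc i \<le> j" "j < k" for j
    unfolding es'_def using that diff_less_mono[of j k "Suc i"] by (simp add: nth_append)
  show "es' ! (k - Suc i) = g"
    unfolding es'_def using ik by (simp add: nth_append)
  show "vs' ! (j - Suc i) = x j" if "Suc i \<le> j" "j \<le> k" for j
  proof -
    have "j - Suc i < Suc k - Suc i" using that by (intro diff_less_mono) auto
    then show ?thesis unfolding vs'_def using that by (simp add: nth_append del: upt_Suc)
  qed
  have "length vs = Suc (length es)" using P by (simp add: path_def bpath_def)
  then show "length es' = c + length vs - 1" unfolding es'_def using ik by simp
qed

end

end

section \<open>Averaging and arithmetic for the extremal choice\<close>

lemma exists_heavy_pair:
  fixes f :: "'b \<Rightarrow> nat"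
  assumes "2 \<le> card J"
  shows "\<exists>j\<in>J. \<exists>k\<in>J. j \<noteq> k \<and> 2 * sum f J \<le> card J * (f j + f k)"
proof -
  have fin: "finite J" using assms by (intro card_ge_0_finite) simp
  have ne: "J \<noteq> {}" using assms by auto
  have mx: "\<exists>j\<in>A. \<forall>i\<in>A. f i \<le> f j" if "finite A" "A \<noteq> {}" for A
  proof -
    have "Max (f ` A) \<in> f ` A" using that by simp
    then obtain j where "j \<in> A" "Max (f ` A) = f j" by auto
    then show ?thesis using that Max_ge[of "f ` A"] by (metis finite_imageI imageI)
  qed
  obtain j where j: "j \<in> J" "\<And>i. i \<in> J \<Longrightarrow> f i \<le> f j"
    using mx[OF fin ne] by blast
  have cJ: "card (J - {j}) = card J - 1" using j fin by simp
  have fin': "finite (J - {j})" using fin by simp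
  have ne': "J - {j} \<noteq> {}" using cJ assms by (metis card.empty diff_is_0_eq not_less_eq_eq numeral_2_eq_2 One_nat_def)
  obtain k where k: "k \<in> J - {j}" "\<And>i. i \<in> J - {j} \<Longrightarrow> f i \<le> f k"
    using mx[OF fin' ne'] by blast
  obtain b where b: "card J = b + 2" using assms by (metis add.commute le_Suc_ex)
  have "sum f J = f j + sum f (J - {j})" using j fin by (simp add: sum.remove)
  also have "sum f (J - {j}) \<le> card (J - {j}) * f k"
    using k(2) sum_bounded_above[of "J - {j}" f "f k"] by simp
  finally have "2 * sum f J \<le> 2 * f j + 2 * (b + 1) * f k" using cJ b by simp
  also have "\<dots> \<le> card J * (f j + f k)"
  proof -
    have "b * f k \<le> b * f j" using j k by (intro mult_le_mono2) auto
    then show ?thesis by (simp add: b algebra_simps)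
  qed
  finally have "2 * sum f J \<le> card J * (f j + f k)" .
  then show ?thesis using j(1) k(1) by (intro bexI[of _ j] bexI[of _ k] conjI) auto
qed

text \<open>\<open>a\<close> is the largest number of contacts, \<open>S\<close> the sum of the
  cycle degrees of \<open>a\<close> successors, \<open>D\<close> the sum for a heavy pair and
  \<open>q\<close> its number of lost vertices. The excess \<open>T\<close> of \<open>D\<close> over
  \<open>c + 1\<close> is large by \<open>1\<close> and \<open>2\<close>, but small by
  \<open>3\<close> and \<open>4\<close>, because lost vertices cost edges. The hypothesis
  \<open>a + 3 \<le> c\<close> makes the two bounds incompatible; the remaining range is treated by
  \<open>dense_contact_cut\<close>.\<close>

lemma extremal_degree_arith:
  fixes a c \<delta> m S D q :: nat
  assumes "4 \<le> a" "a + 3 \<le> c" "c < \<delta>" "m + 10 \<le> 4 * \<delta>"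
    and 1: "(a + 1) * \<delta> + c \<le> m + (a + S)" and 2: "2 * S \<le> a * D"
    and 3: "(q + 2) * \<delta> + c \<le> m + D + q * a" and 4: "D \<le> c + 1 + q"
  shows False
proof -
  obtain s where s: "a = 4 + s" using assms le_Suc_ex by blast
  obtain r where r: "\<delta> = a + 4 + r" using assms le_Suc_ex[of "a + 4" \<delta>] by auto
  define T where "T = int D - int c - 1"
  have Tq: "T \<le> int q" using 4 by (simp add: T_def)
  have i3: "(int q - 2) * int \<delta> + 10 + int c \<le> int D + int q * int a"
  proof -
    have "int ((q + 2) * \<delta> + c) \<le> int (m + D + q * a)" using 3 by (simp only: of_nat_le_iff)
    then show ?thesis using assms(4) by (simp add: algebra_simps)
  qed
  have "T * (int \<delta> - int a - 1) \<le> 2 * int \<delta> - 9"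
  proof -
    have "T * (int \<delta> - int a) \<le> int q * (int \<delta> - int a)"
      using Tq r by (intro mult_right_mono) auto
    then show ?thesis using i3 by (simp add: T_def algebra_simps)
  qed
  then have "int a * (T * (int \<delta> - int a - 1)) \<le> int a * (2 * int \<delta> - 9)"
    by (intro mult_left_mono) auto
  moreover have aT: "(int a - 4) * int \<delta> - 2 * int a + 18 \<le> int a * T"
  proof -
    have "int ((a + 1) * \<delta> + c) \<le> int (m + (a + S))" "int (2 * S) \<le> int (a * D)"
      using 1 2 by (simp_all only: of_nat_le_iff)
    then have "2 * ((int a - 3) * int \<delta> + int c - int a + 10) \<le> int a * int D"
      using assms(4) by (simp add: algebra_simps)
    moreover have "(int a - 2) * int c \<le> (int a - 2) * (int \<delta> - 1)"
      using assms by (intro mult_left_mono) auto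
    ultimately show ?thesis by (simp add: T_def algebra_simps)
  qed
  have "((int a - 4) * int \<delta> - 2 * int a + 18) * (int \<delta> - int a - 1) \<le> int a * T * (int \<delta> - int a - 1)"
    using aT r by (intro mult_right_mono) auto
  ultimately have "((int a - 4) * int \<delta> - 2 * int a + 18) * (int \<delta> - int a - 1) \<le> int a * (2 * int \<delta> - 9)"
    by (simp add: algebra_simps)
  \<comment> \<open>Substituting \<open>a = 4 + s\<close> and \<open>\<delta> = 8 + s + r\<close>
    leaves a polynomial with nonnegative coefficients and constant term 2.\<close>
  then have "int (s*s + 3*s + 7*s*r + 2 + 2*r + r*s*s + s*r*r) \<le> 0"
    by (simp add: r s algebra_simps)
  then have "s*s + 3*s + 7*s*r + 2 + 2*r + r*s*s + s*r*r \<le> 0" by (simp only: of_nat_le_0_iff)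
  then show False by simp
qed

context longest_cycle begin

lemma ear_no_closing:
  assumes C: "cyc x y" and ear: "ear x y i k vs es f g" and ik: "i < k" "k < i + c"
    and e: "e \<in> E" "e \<notin> y ` {Suc i..<k} \<union> y ` {Suc k..<i + c} \<union> {f, g} \<union> set es" "x (Suc i) \<in> e"
  shows "x (Suc k) \<notin> e"
proof
  assume "x (Suc k) \<in> e"
  note P = ear_path[OF C ear ik]
  let ?es = "map y [Suc i..<k] @ g # rev es @ f # rev (map y [Suc k..<i + c])"
  have "e \<notin> set ?es" unfolding P(5) by (rule e(2))
  then have "e \<in> outer (set ?es) (x (Suc i)) \<inter> outer (set ?es) (x (Suc k))"
    using e \<open>x (Suc k) \<in> e\<close> unfolding outer_def by blast
  moreover have "vs \<noteq> []" using ear by (auto simp: ear_def path_def bpath_def)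
  then have "c < c + length vs" by simp
  ultimately show False using path_ends_disjoint[OF P(1)] unfolding P(2-4) by blast
qed

lemma ear_outer:
  assumes "cyc x y" "ear x y i k vs es f g" "i < k" "k < i + c"
  shows "outer (range y) (x (Suc i)) \<inter> outer (range y) (x (Suc k)) \<subseteq> set es \<union> {f, g}"
  using ear_no_closing[OF assms] by (auto simp: outer_def)

lemma ear_skip:
  assumes C: "cyc x y" and ear: "ear x y i k vs es f g" and ik: "i < k" "k < i + c"
    and u: "x (Suc i) \<in> y k"
  shows "g = y k"
proof (rule ccontr)
  assume "g \<noteq> y k"
  have ypi: "y i = y (i + c)" by (simp add: cyc_period[OF C])
  have "y k \<notin> y ` {Suc i..<k}" "y k \<notin> y ` {Suc k..<i + c}" "y k \<noteq> y i"
    using ik cyc_inj(2)[OF C] by auto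
  moreover have "f = y k \<longrightarrow> f = y i" "y k \<notin> set es" using ear by (auto simp: ear_def)
  ultimately show False
    using ear_no_closing[OF C ear ik, of "y k"] u \<open>g \<noteq> y k\<close> cyc_inc[OF C, of k] cyc_sub[OF C] by auto
qed

text \<open>The path of \<open>ear_path\<close> has \<open>length vs\<close> vertices too many for a
  cycle, so every crossing has to drop at least that many.\<close>

lemma ear_crossing:
  assumes C: "cyc x y" and ear: "ear x y i k vs es f g" and ik: "i < k" "k < i + c"
    and ab: "i < a" "a < b" "b \<le> k" "x (Suc k) \<in> y a" "x (Suc i) \<in> y b"
  shows "length vs \<le> b - a"
proof -
  note P = ear_path[OF C ear ik]
  let ?es = "map y [Suc i..<k] @ g # rev es @ f # rev (map y [Suc k..<i + c])"
  \<comment> \<open>At \<open>b = k\<close> the path carries \<open>g\<close> in place of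
    \<open>y k\<close>; \<open>ear_skip\<close> identifies them.\<close>
  have "?es ! (b - Suc i) = y b"
    using P(6)[of b] P(7) ear_skip[OF C ear ik] ab by (cases "b = k") auto
  moreover have "?es ! (a - Suc i) = y a" using P(6)[of a] ab by auto
  moreover have "b - Suc i < length ?es" unfolding P(9) using ik ab ear
    by (cases vs) (auto simp: ear_def path_def bpath_def)
  ultimately have "c + length vs \<le> c + (b - Suc i - (a - Suc i))"
    using path_crossing_length[OF P(1), of "a - Suc i" "b - Suc i"] P(2-4) ab
    by (simp add: diff_less_mono)
  then show ?thesis using ab by simp
qed

lemma ear_lost:
  assumes C: "cyc x y" and ear: "ear x y i k vs es f g" and ik: "i < k" "k < i + c"
    and b: "Suc i < b" "b \<le> k" "x (Suc k) \<in> y (b - 1)" "x (Suc i) \<in> y b"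
  shows "x b \<in> lost (map x [Suc i..<Suc k] @ rev vs @ rev (map x [Suc k..<Suc (i + c)]))
    (map y [Suc i..<k] @ g # rev es @ f # rev (map y [Suc k..<i + c]))"
proof -
  note P = ear_path[OF C ear ik]
  let ?vs = "map x [Suc i..<Suc k] @ rev vs @ rev (map x [Suc k..<Suc (i + c)])"
  let ?es = "map y [Suc i..<k] @ g # rev es @ f # rev (map y [Suc k..<i + c])"
  define s where "s = b - Suc i - 1"
  have s: "Suc s = b - Suc i" "s = b - 1 - Suc i" using b by (auto simp: s_def)
  have "?es ! (b - Suc i) = y b"
    using P(6)[of b] P(7) ear_skip[OF C ear ik] b by (cases "b = k") auto
  moreover have "?es ! (b - 1 - Suc i) = y (b - 1)" using P(6)[of "b - 1"] b by auto
  moreover have "b - Suc i < length ?es" unfolding P(9) using ik b ear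
    by (cases vs) (auto simp: ear_def path_def bpath_def)
  moreover have "?vs ! (b - Suc i) = x b" using P(8)[of b] b by simp
  ultimately show ?thesis unfolding lost_def mem_Collect_eq P(2,3)
    using b s by (intro exI[of _ s]) metis
qed

lemma cyc_offset:
  assumes C: "cyc x y"
  shows "v \<in> range x \<Longrightarrow> \<exists>d<c. x (Suc (j + d)) = v" "e \<in> range y \<Longrightarrow> \<exists>d<c. y (Suc (j + d)) = e"
proof -
  have "\<exists>d<c. x (Suc (j + d)) = x i \<and> y (Suc (j + d)) = y i" for i
  proof -
    obtain k where k: "k \<in> {Suc j..<Suc j + c}" "x k = x i" "y k = y i"
      using cyc_window[OF C, of "Suc j" i] by blast
    then have "Suc (j + (k - Suc j)) = k" "k - Suc j < c" by auto
    then show ?thesis using k(2,3) by metis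
  qed
  then show "v \<in> range x \<Longrightarrow> \<exists>d<c. x (Suc (j + d)) = v" "e \<in> range y \<Longrightarrow> \<exists>d<c. y (Suc (j + d)) = e"
    by blast+
qed

section \<open>Components outside the cycle\<close>

definition comp :: "(nat \<Rightarrow> 'a) \<Rightarrow> (nat \<Rightarrow> 'a set) \<Rightarrow> 'a \<Rightarrow> 'a set" where
  "comp x y z = {q. (z, q) \<in> (linked (V - range x) (E - range y))\<^sup>*}"

definition comp_edges :: "(nat \<Rightarrow> 'a) \<Rightarrow> (nat \<Rightarrow> 'a set) \<Rightarrow> 'a \<Rightarrow> 'a set set" where
  "comp_edges x y z = {e \<in> E - range y. e \<inter> comp x y z \<noteq> {}}"

lemma comp_self: "z \<in> comp x y z"
  by (simp add: comp_def)

lemma comp_sub: "z \<in> V - range x \<Longrightarrow> comp x y z \<subseteq> V - range x"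
  by (auto simp: comp_def linked_def elim: rtranclE)

lemma comp_closed:
  assumes "z \<in> V - range x" "p \<in> comp x y z" "e \<in> E - range y" "p \<in> e" "q \<in> e" "q \<notin> range x"
  shows "q \<in> comp x y z"
proof -
  have "(p, q) \<in> linked (V - range x) (E - range y)"
    using assms comp_sub[OF assms(1)] E_Pow by (auto simp: linked_def)
  then show ?thesis using assms(2) by (auto simp: comp_def intro: rtrancl_into_rtrancl)
qed

text \<open>Each edge of a shortest path from \<open>Q\<close> to \<open>Q'\<close> has its later
  vertex outside \<open>Q\<close> and its earlier one outside \<open>Q'\<close>. So an edge that
  meets the component only inside \<open>Q\<close>, or only inside \<open>Q'\<close>, is not on the
  path and stays free for attaching it.\<close>

lemma comp_path:
  assumes z: "z \<in> V - range x" and Q: "Q \<subseteq> comp x y z" "Q' \<subseteq> comp x y z" "Q \<noteq> {}" "Q' \<noteq> {}"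
  obtains vs es where "path vs es" "set vs \<subseteq> comp x y z" "set es \<subseteq> comp_edges x y z"
    "hd vs \<in> Q" "last vs \<in> Q'" "\<And>f. f \<inter> comp x y z \<subseteq> Q \<or> f \<inter> comp x y z \<subseteq> Q' \<Longrightarrow> f \<notin> set es"
proof -
  let ?L = "linked (V - range x) (E - range y)"
  obtain p q where pq: "p \<in> Q" "q \<in> Q'" using Q by blast
  have "(z, p) \<in> ?L\<^sup>*" "(z, q) \<in> ?L\<^sup>*" using pq Q by (auto simp: comp_def)
  then have "(p, z) \<in> ?L\<^sup>*" "(z, q) \<in> ?L\<^sup>*"
    by (auto intro: symD[OF sym_rtrancl[OF sym_linked]])
  then have "(p, q) \<in> ?L\<^sup>*" by (rule rtrancl_trans)
  moreover have "p \<in> V - range x" using pq Q comp_sub[OF z] by blast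
  ultimately obtain vs es where P: "bpath vs es" "distinct vs" "distinct es"
    "set vs \<subseteq> V - range x" "set es \<subseteq> E - range y" "hd vs \<in> Q" "last vs \<in> Q'"
    and noQ: "\<And>i. 0 < i \<Longrightarrow> i < length vs \<Longrightarrow> vs ! i \<notin> Q"
    and noQ': "\<And>i. i < length es \<Longrightarrow> vs ! i \<notin> Q'"
    using shortest_bpath[of p Q q Q' "V - range x" "E - range y"] pq by blast
  have len: "length vs = Suc (length es)" using P by (simp add: bpath_def)
  have incomp: "vs ! i \<in> comp x y z" if "i < length vs" for i
    using that
  proof (induction i)
    case 0
    have "vs ! 0 = hd vs" using len by (cases vs) auto
    then show ?case using P Q by auto
  next
    case (Suc i)
    then have "es ! i \<in> set es" "vs ! Suc i \<in> set vs" using len by auto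
    then have "es ! i \<in> E - range y" "vs ! Suc i \<notin> range x" using P(4,5) by blast+
    moreover have "vs ! i \<in> es ! i" "vs ! Suc i \<in> es ! i"
      using P(1) Suc.prems len by (auto simp: bpath_def)
    moreover have "vs ! i \<in> comp x y z" using Suc by simp
    ultimately show ?case using comp_closed[OF z] by blast
  qed
  show thesis
  proof (rule that)
    show "path vs es" using P by (auto simp: path_def)
    show "set vs \<subseteq> comp x y z" using incomp by (auto simp: in_set_conv_nth)
    show "set es \<subseteq> comp_edges x y z"
    proof
      fix e assume e: "e \<in> set es"
      then obtain i where "i < length es" "e = es ! i" by (auto simp: in_set_conv_nth)
      then have "vs ! i \<in> e \<inter> comp x y z" using incomp[of i] P len by (auto simp: bpath_def)
      then show "e \<in> comp_edges x y z" using e P by (auto simp: comp_edges_def)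
    qed
    show "hd vs \<in> Q" "last vs \<in> Q'" by fact+
    fix f assume f: "f \<inter> comp x y z \<subseteq> Q \<or> f \<inter> comp x y z \<subseteq> Q'"
    show "f \<notin> set es"
    proof
      assume "f \<in> set es"
      then obtain i where i: "i < length es" "f = es ! i" by (auto simp: in_set_conv_nth)
      then have "vs ! i \<in> f \<inter> comp x y z" "vs ! Suc i \<in> f \<inter> comp x y z"
        using incomp[of i] incomp[of "Suc i"] P len by (auto simp: bpath_def)
      then show False using f noQ[of "Suc i"] noQ'[of i] i len by auto
    qed
  qed
qed

end

section \<open>Contacts of an outside vertex\<close>

context longest_cycle begin

lemma comp_edges_sub: "comp_edges x y z \<subseteq> E - range y"
  by (auto simp: comp_edges_def)

lemma edge_in_comp_edges: "p \<in> comp x y z \<Longrightarrow> e \<in> E - range y \<Longrightarrow> p \<in> e \<Longrightarrow> e \<in> comp_edges x y z"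
  by (auto simp: comp_edges_def)

lemma not_range_subset: "cyc x y \<Longrightarrow> finite S \<Longrightarrow> card S < c \<Longrightarrow> \<not> range x \<subseteq> S"
  using card_ranges(1)[of x y] card_mono[of S "range x"] by auto

lemma comp_ear_path:
  assumes C: "cyc x y" and z: "z \<in> V - range x"
    and fg: "f \<inter> comp x y z \<noteq> {}" "g \<inter> comp x y z \<noteq> {}"
  obtains vs es where "path vs es" "set vs \<subseteq> comp x y z" "set es \<subseteq> comp_edges x y z"
    "hd vs \<in> f" "last vs \<in> g" "f \<notin> set es" "g \<notin> set es"
    "set vs \<inter> range x = {}" "set es \<inter> range y = {}" "vs \<noteq> []"
proof -
  obtain vs es where P: "path vs es" "set vs \<subseteq> comp x y z" "set es \<subseteq> comp_edges x y z"
    "hd vs \<in> f \<inter> comp x y z" "last vs \<in> g \<inter> comp x y z"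
    "\<And>h. h \<inter> comp x y z \<subseteq> f \<inter> comp x y z \<or> h \<inter> comp x y z \<subseteq> g \<inter> comp x y z \<Longrightarrow> h \<notin> set es"
    using comp_path[OF z, of "f \<inter> comp x y z" y "g \<inter> comp x y z"] fg by blast
  show thesis
  proof (rule that[OF P(1-3)])
    show "hd vs \<in> f" "last vs \<in> g" using P(4,5) by auto
    show "f \<notin> set es" "g \<notin> set es" using P(6)[of f] P(6)[of g] by auto
    show "set vs \<inter> range x = {}" using P(2) comp_sub[OF z, of y] by blast
    show "set es \<inter> range y = {}" using P(3) comp_edges_sub[of x y z] by blast
    show "vs \<noteq> []" using P(1) by (auto simp: path_def bpath_def)
  qed
qed

text \<open>Otherwise the edge between \<open>x i\<close> and \<open>x (Suc i)\<close> could be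
  replaced by a path through the component, which adds at least one vertex. As \<open>y i\<close> is
  the replaced edge, it may itself serve as \<open>f\<close> or \<open>g\<close>.\<close>

lemma no_insertion:
  assumes C: "cyc x y" and z: "z \<in> V - range x"
    and f: "f \<in> comp_edges x y z \<or> f = y i" "x i \<in> f" "f \<inter> comp x y z \<noteq> {}"
    and g: "g \<in> comp_edges x y z \<or> g = y i" "x (Suc i) \<in> g" "g \<inter> comp x y z \<noteq> {}"
  shows "f = g"
proof (rule ccontr)
  assume "f \<noteq> g"
  obtain vs es where P: "path vs es" "set vs \<subseteq> comp x y z" "set es \<subseteq> comp_edges x y z"
    "hd vs \<in> f" "last vs \<in> g" "f \<notin> set es" "g \<notin> set es"
    "set vs \<inter> range x = {}" "set es \<inter> range y = {}" "vs \<noteq> []"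
    by (rule comp_ear_path[OF C z f(3) g(3)])
  have yi: "y i \<notin> y ` {Suc i..<i + c}" using cyc_inj(2)[OF C] by auto
  have E: "f \<in> E" "g \<in> E" using f(1) g(1) cyc_sub[OF C] comp_edges_sub[of x y z] by auto
  have Y: "f \<notin> y ` {Suc i..<i + c}" "g \<notin> y ` {Suc i..<i + c}"
    using f(1) g(1) yi comp_edges_sub[of x y z] by auto
  have "i + length vs < Suc i"
    by (rule detour[OF C P(1,8,9) lessI _ E \<open>f \<noteq> g\<close> P(6,7) Y f(2) P(4,5) g(2)])
      (use c_ge_2 in simp)
  then show False using P(10) by simp
qed

text \<open>\<open>z\<close> misses at most two cycle edges. Every other contact forces two misses:
  if a component edge touches a cycle vertex, the two cycle edges around that vertex; if another
  component vertex lies on a cycle edge, the two neighbours of that edge. So there is at most one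
  such contact, and together with \<open>z\<close> it is a separator of size two.\<close>

lemma dense_contact_cut:
  assumes C: "cyc x y" and z: "z \<in> V - range x"
    and a: "4 \<le> dg (range y) z" "c \<le> dg (range y) z + 2"
  shows False
proof -
  let ?K = "comp x y z" and ?L = "comp_edges x y z"
  define NA where "NA = {e \<in> range y. z \<notin> e}"
  have fy: "finite (range y)" using cyc_sub[OF C] finite_E finite_subset by blast
  have "card (range y) = card {e \<in> range y. z \<in> e} + card NA"
    unfolding NA_def using fy
    by (subst card_Un_disjoint[symmetric]) (auto intro!: arg_cong[where f = card])
  then have cNA: "card NA + dg (range y) z = c" using card_ranges[OF C] by (simp add: dg_def)
  have fNA: "finite NA" using fy by (simp add: NA_def)
  have pair: "NA = {e, f}" if "e \<in> NA" "f \<in> NA" "e \<noteq> f" for e f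
    using card_subset_eq[OF fNA, of "{e, f}"] that cNA a card_mono[OF fNA, of "{e, f}"] by force
  \<comment> \<open>Two missed edges besides at least four at \<open>z\<close>; with six positions
    the indices below cannot coincide around the cycle.\<close>
  have two: "6 \<le> c" if "e \<in> NA" "f \<in> NA" "e \<noteq> f" for e f
    using pair[OF that] that cNA a by simp
  have K: "?K \<subseteq> V - range x" by (rule comp_sub[OF z])
  have in_NA: "y j \<in> NA" if "z \<notin> y j" for j using that by (auto simp: NA_def)
  have touch_left: "z \<notin> y k" if "e \<in> ?L" "x k \<in> e" for e k
    using no_insertion[OF C z, of e k "y k"] that cyc_inc[OF C, of k] comp_self[of z x y]
    by (auto simp: comp_edges_def)
  have touch_right: "z \<notin> y k" if "e \<in> ?L" "x (Suc k) \<in> e" for e k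
    using no_insertion[OF C z, of "y k" k e] that cyc_inc[OF C, of k] comp_self[of z x y]
    by (auto simp: comp_edges_def)
  have ends_ne: "2 \<le> length vs" if "path vs es" "hd vs \<noteq> last vs" for vs es
    using that by (cases vs rule: list.exhaust; cases "tl vs") (auto simp: path_def bpath_def)
  \<comment> \<open>A path from \<open>p\<close> to \<open>z\<close> has two vertices at least,
    while the detour by \<open>y k\<close> and \<open>y (Suc k)\<close> bypasses only
    \<open>x (Suc k)\<close>.\<close>
  have skip_next: "z \<notin> y (Suc k)" if p: "p \<in> ?K" "p \<noteq> z" "p \<in> y k" for p k
  proof
    assume zk: "z \<in> y (Suc k)"
    obtain vs es where P: "path vs es" "set vs \<subseteq> ?K" "set es \<subseteq> ?L" "hd vs \<in> {p}" "last vs \<in> {z}"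
      "\<And>f. f \<inter> ?K \<subseteq> {p} \<or> f \<inter> ?K \<subseteq> {z} \<Longrightarrow> f \<notin> set es"
      using comp_path[OF z, of "{p}" y "{z}"] p comp_self[of z] by blast
    have "k + length vs < k + 2"
    proof (rule detour[OF C P(1), where f = "y k" and g = "y (Suc k)"])
      show "set vs \<inter> range x = {}" using P(2) K by blast
      show "set es \<inter> range y = {}" using P(3) comp_edges_sub by blast
      show "y k \<notin> set es" "y (Suc k) \<notin> set es" using P(3) comp_edges_sub[of x y z] by blast+
      show "y k \<notin> y ` {k + 2..<k + c}" "y (Suc k) \<notin> y ` {k + 2..<k + c}" "y k \<noteq> y (Suc k)"
        using cyc_inj(2)[OF C] c_ge_2 by auto
      show "x k \<in> y k" "x (k + 2) \<in> y (Suc k)" using cyc_inc[OF C, of k] cyc_inc[OF C, of "Suc k"] by auto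
    qed (use p cyc_sub[OF C] c_ge_2 P(4,5) zk in auto)
    then show False using ends_ne[OF P(1)] P(4,5) p by auto
  qed
  have skip_prev: "z \<notin> y k" if p: "p \<in> ?K" "p \<noteq> z" "p \<in> y (Suc k)" for p k
  proof
    assume zk: "z \<in> y k"
    obtain vs es where P: "path vs es" "set vs \<subseteq> ?K" "set es \<subseteq> ?L" "hd vs \<in> {z}" "last vs \<in> {p}"
      "\<And>f. f \<inter> ?K \<subseteq> {z} \<or> f \<inter> ?K \<subseteq> {p} \<Longrightarrow> f \<notin> set es"
      using comp_path[OF z, of "{z}" y "{p}"] p comp_self[of z] by blast
    have "k + length vs < k + 2"
    proof (rule detour[OF C P(1), where f = "y k" and g = "y (Suc k)"])
      show "set vs \<inter> range x = {}" using P(2) K by blast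
      show "set es \<inter> range y = {}" using P(3) comp_edges_sub by blast
      show "y k \<notin> set es" "y (Suc k) \<notin> set es" using P(3) comp_edges_sub[of x y z] by blast+
      show "y k \<notin> y ` {k + 2..<k + c}" "y (Suc k) \<notin> y ` {k + 2..<k + c}" "y k \<noteq> y (Suc k)"
        using cyc_inj(2)[OF C] c_ge_2 by auto
      show "x k \<in> y k" "x (k + 2) \<in> y (Suc k)" using cyc_inc[OF C, of k] cyc_inc[OF C, of "Suc k"] by auto
    qed (use p cyc_sub[OF C] c_ge_2 P(4,5) zk in auto)
    then show False using ends_ne[OF P(1)] P(4,5) p by auto
  qed
  define TX where "TX = {v \<in> range x. \<exists>e\<in>?L. v \<in> e}"
  define TY where "TY = {e \<in> range y. \<exists>p\<in>?K - {z}. p \<in> e}"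
  have X_contact: "y j \<in> NA" "y (Suc j) \<in> NA" if "x (Suc j) \<in> TX" for j
    using that touch_left[of _ "Suc j"] touch_right[of _ j] in_NA by (auto simp: TX_def)
  have Y_contact: "y j \<in> NA" "y (Suc (Suc j)) \<in> NA" if "y (Suc j) \<in> TY" for j
    using that skip_next[of _ "Suc j"] skip_prev[of _ j] in_NA by (auto simp: TY_def)
  have inj: "y i = y j \<longleftrightarrow> i = j" if "i < j + c" "j < i + c" for i j
    using cyc_inj(2)[OF C that] .
  \<comment> \<open>A contact uses up all of \<open>NA\<close>, so a second contact would have to
    sit at the same place.\<close>
  have "\<exists>v. TX \<subseteq> {v} \<and> TY = {} \<or> TX = {} \<and> (\<exists>e. TY \<subseteq> {e})"
  proof (cases "TX = {}")
    case False
    then obtain v where v: "v \<in> TX" by blast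
    then obtain j where j: "x (Suc j) = v" "j < c"
      using cyc_offset(1)[OF C, of v 0] by (auto simp: TX_def)
    note jNA = X_contact[of j, unfolded j(1), OF v]
    have jj: "y j \<noteq> y (Suc j)" using inj[of j "Suc j"] c_ge_2 by simp
    note NAj = pair[OF jNA jj]
    have c6: "6 \<le> c" by (rule two[OF jNA jj])
    have "TX \<subseteq> {v}"
    proof
      fix w assume w: "w \<in> TX"
      then obtain d where d: "x (Suc (j + d)) = w" "d < c"
        using cyc_offset(1)[OF C, of w j] unfolding TX_def by blast
      have "y (j + d) \<in> {y j, y (Suc j)}" "y (Suc (j + d)) \<in> {y j, y (Suc j)}"
        using X_contact[of "j + d"] d w NAj by auto
      then have "d = 0 \<or> d = 1" "d = 0 \<or> Suc d = c"
        using inj[of "j + d" j] inj[of "j + d" "Suc j"] inj[of "Suc (j + d)" j] inj[of "Suc (j + d)" "Suc j"] d c6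
        by (auto simp: less_Suc_eq)
      then show "w \<in> {v}" using d j c6 by auto
    qed
    moreover have "TY = {}"
    proof (rule ccontr)
      assume "TY \<noteq> {}"
      then obtain e where e: "e \<in> TY" by blast
      then obtain d where d: "y (Suc (j + d)) = e" "d < c"
        using cyc_offset(2)[OF C, of e j] unfolding TY_def by blast
      have "y (j + d) \<in> {y j, y (Suc j)}" "y (Suc (Suc (j + d))) \<in> {y j, y (Suc j)}"
        using Y_contact[of "j + d"] d e NAj by auto
      then have "d = 0 \<or> d = 1" "c \<le> Suc (Suc d)"
        using inj[of "j + d" j] inj[of "j + d" "Suc j"] inj[of "Suc (Suc (j + d))" j] inj[of "Suc (Suc (j + d))" "Suc j"] d c6
        by (auto simp: not_less)
      then show False using c6 by auto
    qed
    ultimately show ?thesis by blast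
  next
    case True
    show ?thesis
    proof (cases "TY = {}")
      case False
      then obtain v where v: "v \<in> TY" by blast
      then obtain j where j: "y (Suc j) = v" "j < c"
        using cyc_offset(2)[OF C, of v 0] by (auto simp: TY_def)
      note jNA = Y_contact[of j, unfolded j(1), OF v]
      have jj: "y j \<noteq> y (Suc (Suc j))" using inj[of j "Suc (Suc j)"] c_ge_2 a cNA by simp
      note NAj = pair[OF jNA jj]
      have c6: "6 \<le> c" by (rule two[OF jNA jj])
      have "TY \<subseteq> {v}"
      proof
        fix w assume w: "w \<in> TY"
        then obtain d where d: "y (Suc (j + d)) = w" "d < c"
          using cyc_offset(2)[OF C, of w j] unfolding TY_def by blast
        have "y (j + d) \<in> {y j, y (Suc (Suc j))}" "y (Suc (Suc (j + d))) \<in> {y j, y (Suc (Suc j))}"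
          using Y_contact[of "j + d"] d w NAj by auto
        then have "d = 0 \<or> d = 2" "d = 0 \<or> c \<le> Suc (Suc d)"
          using inj[of "j + d" j] inj[of "j + d" "Suc (Suc j)"] inj[of "Suc (Suc (j + d))" j]
            inj[of "Suc (Suc (j + d))" "Suc (Suc j)"] d c6
          by (auto simp: not_less)
        then show "w \<in> {v}" using d j c6 by auto
      qed
      then show ?thesis using True by blast
    qed (use True in auto)
  qed
  then have "card TX + card TY \<le> 1" "card TX \<le> 1" "finite TX"
    by (auto simp: subset_singleton_iff)
  then have sz: "card (insert z TX) + card TY \<le> 2" "card TX < c" "finite TX"
    using card_insert_le_m1[of 1 TX] c_ge_2 by (auto simp: card_insert_if)
  \<comment> \<open>The component may be \<open>z\<close> alone. Then the separated part has no
    vertex, but it still has an edge, since \<open>z\<close> has fewer than \<delta>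
    contacts.\<close>
  have "outer (range y) z \<noteq> {}"
    using card_outer[of z "range y"] z cyc_sub[OF C] cNA c_less_\<delta> by force
  then have Lne: "?L \<noteq> {}" using comp_self[of z x y] by (auto simp: outer_def comp_edges_def)
  have "V \<subseteq> (?K - {z}) \<union> insert z TX"
  proof (rule conjunct1[OF cut[of "insert z TX" TY "?K - {z}" ?L]])
    show "insert z TX \<subseteq> V" "TY \<subseteq> E" "?K - {z} \<subseteq> V" "?L \<subseteq> E"
      using z cyc_sub[OF C] K comp_edges_sub[of x y z] by (auto simp: TX_def TY_def)
    show "(?K - {z}) \<inter> insert z TX = {}" "?L \<inter> TY = {}"
      using K comp_edges_sub[of x y z] by (auto simp: TX_def TY_def)
    show "e \<in> ?L \<union> TY" if "v \<in> ?K - {z}" "e \<in> E" "v \<in> e" for v e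
      using that edge_in_comp_edges[of v x y z e] by (auto simp: TY_def)
    show "v \<in> ?K - {z} \<union> insert z TX" if ve: "e \<in> ?L" "v \<in> e" for v e
    proof (cases "v \<in> range x")
      case False
      obtain p where "p \<in> ?K" "p \<in> e" "e \<in> E - range y" using ve by (auto simp: comp_edges_def)
      then show ?thesis using comp_closed[OF z, of p y e v] False ve by blast
    qed (use ve in \<open>auto simp: TX_def\<close>)
  qed (use sz Lne in auto)
  then have "range x \<subseteq> TX" using K z cyc_sub(1)[OF C] by blast
  then show False using not_range_subset[OF C sz(3,2)] by blast
qed

text \<open>Among all longest cycles and outside vertices take a pair with the largest number of contacts.
  Every vertex lost from a path with the same edge set has at most as many contacts, so many losses
  would need too many edges.\<close>

lemma outside_degree_le:
  assumes C0: "cyc x0 y0" and z0: "z0 \<in> V - range x0"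
  shows "dg (range y0) z0 \<le> 3"
proof (rule ccontr)
  assume big: "\<not> dg (range y0) z0 \<le> 3"
  define Deg where "Deg = {a. \<exists>x y z. cyc x y \<and> z \<in> V - range x \<and> dg (range y) z = a}"
  have fin_dg: "dg (range y) z \<le> card E" if "cyc x y" for x y z
    unfolding dg_def using cyc_sub[OF that] by (intro card_mono finite_E) auto
  have "finite Deg"
    by (rule finite_subset[of _ "{..card E}"]) (use fin_dg in \<open>auto simp: Deg_def\<close>)
  moreover have in0: "dg (range y0) z0 \<in> Deg" using C0 z0 by (auto simp: Deg_def)
  moreover from in0 have "Deg \<noteq> {}" by blast
  ultimately have mx: "Max Deg \<in> Deg" "\<And>b. b \<in> Deg \<Longrightarrow> b \<le> Max Deg"
    using Max_in[of Deg] Max_ge[of Deg] by blast+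
  define a where "a = Max Deg"
  have a4: "4 \<le> a" using big mx(2)[OF in0] by (simp add: a_def)
  obtain x y z where C: "cyc x y" and z: "z \<in> V - range x" and az: "dg (range y) z = a"
    using mx(1) by (auto simp: Deg_def a_def)
  have amax: "dg (set es) w \<le> a" if K: "cycle vs es" "length vs = c" "w \<in> V - set vs" for vs es w
  proof -
    obtain x' y' where "cyc x' y'" "range x' = set vs" "range y' = set es"
      using cycle_cyc[OF K(1,2)] by blast
    then have "dg (set es) w \<in> Deg" using K(3) unfolding Deg_def by force
    then show ?thesis using mx(2) by (simp add: a_def)
  qed
  define J where "J = {j \<in> {0..<0 + c}. z \<in> y j}"
  have cJ: "card J = a" using dg_range[OF C, of z 0] az by (simp add: J_def)
  \<comment> \<open>The vertex \<open>z\<close> alone is an ear between any two cycle edges that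
    contain it.\<close>
  have ear: "ear x y j k [z] [] (y j) (y k)" if "j \<in> J" "k \<in> J" "j < k" for j k
    using that z cyc_sub[OF C] cyc_inc[OF C] cyc_inj(2)[OF C, of j k]
    by (auto simp: ear_def J_def path_single)
  have disj: "outer (range y) (x (Suc j)) \<inter> outer (range y) (x (Suc k)) = {}"
    if "j \<in> J" "k \<in> J" "j \<noteq> k" for j k
  proof -
    have "outer (range y) (x (Suc j)) \<inter> outer (range y) (x (Suc k)) = {}"
      if jk: "j \<in> J" "k \<in> J" "j < k" for j k
      using ear_outer[OF C ear[OF jk]] jk by (auto simp: J_def outer_def)
    then show ?thesis using that by (metis Int_commute linorder_neqE_nat)
  qed
  have disjz: "outer (range y) (x (Suc j)) \<inter> outer (range y) z = {}" if j: "j \<in> J" for j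
  proof (rule ccontr)
    assume "outer (range y) (x (Suc j)) \<inter> outer (range y) z \<noteq> {}"
    then obtain e where e: "e \<in> E" "e \<notin> range y" "x (Suc j) \<in> e" "z \<in> e" by (auto simp: outer_def)
    have "j + length [z] < Suc j"
    proof (rule detour[OF C path_single, where f = "y j" and g = e])
      show "y j \<notin> y ` {Suc j..<j + c}" using cyc_inj(2)[OF C] by auto
    qed (use e z j cyc_sub[OF C] cyc_inc[OF C] c_ge_2 in \<open>auto simp: J_def\<close>)
    then show False by simp
  qed
  have injU: "inj_on (\<lambda>j. x (Suc j)) J" by (auto simp: inj_on_def J_def cyc_inj(1)[OF C])
  define U where "U = (\<lambda>j. x (Suc j)) ` J"
  have zU: "z \<notin> U" using z by (auto simp: U_def)
  have fU: "finite U" by (simp add: U_def J_def)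
  have cU: "card U = a" using injU cJ by (simp add: U_def card_image)
  define S where "S = (\<Sum>j\<in>J. dg (range y) (x (Suc j)))"
  have "card (insert z U) * \<delta> + card ({}::'a set set) + card (range y) \<le> card E + (\<Sum>v\<in>insert z U. dg (range y) v)"
  proof (rule outer_count)
    show "insert z U \<subseteq> V" using z cyc_sub[OF C] by (auto simp: U_def)
    fix u v assume "u \<in> insert z U" "v \<in> insert z U" "u \<noteq> v"
    then show "outer (range y) u \<inter> outer (range y) v = {}"
      using disj disjz unfolding U_def by (auto simp: Int_commute; metis Int_commute)
  qed (use cyc_sub[OF C] in auto)
  then have c1: "(a + 1) * \<delta> + c \<le> card E + (a + S)"
    using zU fU cU card_ranges[OF C] az injU by (simp add: S_def U_def sum.reindex)
  obtain j k where jk: "j \<in> J" "k \<in> J" "j \<noteq> k"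
    "2 * S \<le> card J * (dg (range y) (x (Suc j)) + dg (range y) (x (Suc k)))"
    using exists_heavy_pair[of J "\<lambda>j. dg (range y) (x (Suc j))"] cJ a4 unfolding S_def by auto
  obtain j k where jk: "j \<in> J" "k \<in> J" "j < k"
    "2 * S \<le> a * (dg (range y) (x (Suc j)) + dg (range y) (x (Suc k)))"
    using jk cJ by (metis add.commute linorder_neqE_nat)
  have kc: "k < j + c" using jk by (auto simp: J_def)
  note P = ear_path[OF C ear[OF jk(1-3)] jk(3) kc]
  let ?vs = "map x [Suc j..<Suc k] @ rev [z] @ rev (map x [Suc k..<Suc (j + c)])"
  let ?es = "map y [Suc j..<k] @ y k # rev [] @ y j # rev (map y [Suc k..<j + c])"
  \<comment> \<open>The ear uses the two bypassed edges \<open>y j\<close> and \<open>y k\<close>.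
    So the path has the edge set of the cycle, and contacts with the path are contacts with the
    cycle.\<close>
  have es: "set ?es = range y"
  proof -
    have "{j..<j + c} = {Suc j..<k} \<union> {Suc k..<j + c} \<union> {j, k}" using jk(3) kc by auto
    then show ?thesis unfolding P(5) range_window(2)[OF C, of j] by auto
  qed
  define q where "q = card (lost ?vs ?es)"
  have len: "c < length ?vs" "length ?vs = c + 1" unfolding P(4) by auto
  have ne: "x (Suc j) \<noteq> x (Suc k)" using cyc_inj(1)[OF C, of "Suc j" "Suc k"] jk kc by auto
  have les: "length ?es = c" unfolding P(9) by simp
  have lost_a: "dg (set ?es) w \<le> a" if w: "w \<in> lost ?vs ?es" for w
  proof -
    obtain vs' es' where C': "cycle vs' es'" "Suc (length vs') = length ?vs" "w \<notin> set vs'" "set es' = set ?es"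
      using lost_cycle[OF P(1) w] by blast
    moreover have "w \<in> V" using lost_subset[OF P(1)] w by blast
    ultimately show ?thesis using amax[OF C'(1), of w] len by simp
  qed
  have "(q + 2) * \<delta> + length ?es \<le> card E + (dg (set ?es) (hd ?vs) + dg (set ?es) (last ?vs)) + q * a"
    unfolding q_def by (rule lost_count[OF P(1) len(1) _ lost_a]) (use ne P(2,3) in auto)
  then have c3: "(q + 2) * \<delta> + c \<le> card E + (dg (range y) (x (Suc j)) + dg (range y) (x (Suc k))) + q * a"
    unfolding les es P(2,3) .
  have c4: "dg (range y) (x (Suc j)) + dg (range y) (x (Suc k)) \<le> c + 1 + q"
    using dg_ends_le[OF P(1)] unfolding P(2,3) es len(2) q_def .
  have "\<not> a + 3 \<le> c"
    using extremal_degree_arith[OF a4 _ c_less_\<delta> card_E c1 jk(4) c3 c4] by blast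
  then have "c \<le> a + 2" by linarith
  then show False using dense_contact_cut[OF C z] az a4 by auto
qed

text \<open>Each lost vertex is outside a longest cycle with the same edges, hence has at most three
  contacts. For two lost vertices the edge count would read
  \<open>4 * \<delta> + 10 \<le> 4 * \<delta> + 9\<close>, and further ones do not help because
  \<open>4 \<le> \<delta>\<close>.\<close>

lemma card_lost_le_1:
  assumes P: "path vs es" and len: "length vs = c + 1"
  shows "card (lost vs es) \<le> 1"
proof (rule ccontr)
  assume many: "\<not> card (lost vs es) \<le> 1"
  define q where "q = card (lost vs es)"
  have les: "length es = c" using P len by (simp add: path_def bpath_def)
  have ne: "hd vs \<noteq> last vs"
  proof -
    have "vs \<noteq> []" "distinct vs" using P len by (auto simp: path_def)
    then show ?thesis using len c_ge_2
      by (auto simp: hd_conv_nth last_conv_nth nth_eq_iff_index_eq)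
  qed
  have small: "dg (set es) w \<le> 3" if w: "w \<in> lost vs es" for w
  proof -
    obtain vs' es' where C': "cycle vs' es'" "Suc (length vs') = length vs" "w \<notin> set vs'" "set es' = set es"
      using lost_cycle[OF P w] by blast
    obtain x y where "cyc x y" "range x = set vs'" "range y = set es'"
      using cycle_cyc[OF C'(1)] C'(2) len by auto
    then show ?thesis using outside_degree_le[of x y w] C' lost_subset[OF P] w by auto
  qed
  have "(q + 2) * \<delta> + c \<le> card E + (dg (set es) (hd vs) + dg (set es) (last vs)) + q * 3"
    using lost_count[OF P _ ne small] len les by (simp add: q_def)
  moreover have "dg (set es) (hd vs) + dg (set es) (last vs) \<le> c + 1 + q"
    using dg_ends_le[OF P] len by (simp add: q_def)
  ultimately have "(q + 2) * \<delta> + 10 \<le> 4 * \<delta> + 1 + q * 4" using card_E by linarith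
  moreover obtain b where b: "q = b + 2" using many by (metis add.commute le_Suc_ex not_less_eq_eq numeral_2_eq_2 One_nat_def q_def)
  moreover have "b * 4 \<le> b * \<delta>" using \<delta>_ge_4 by (intro mult_le_mono2)
  moreover have "(q + 2) * \<delta> = b * \<delta> + 4 * \<delta>" using b by (simp add: algebra_simps)
  ultimately show False using b by linarith
qed

section \<open>Cycle degrees of the successors of two attachments\<close>

lemma arc_count:
  assumes "i < k"
  shows "card {b \<in> {Suc i..k}. P b} + card {b \<in> {Suc i..<k}. Q b} \<le> (k - i) + card {b \<in> {Suc (Suc i)..k}. P b \<and> Q (b - 1)}"
proof -
  let ?A = "{b \<in> {Suc i..k}. P b}" and ?B = "Suc ` {b \<in> {Suc i..<k}. Q b}"
  have "card ?A + card ?B = card (?A \<union> ?B) + card (?A \<inter> ?B)" by (intro card_Un_Int) auto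
  moreover have "card (?A \<union> ?B) \<le> card {Suc i..k}" by (intro card_mono) auto
  moreover have "card (?A \<inter> ?B) \<le> card {b \<in> {Suc (Suc i)..k}. P b \<and> Q (b - 1)}"
    by (intro card_mono) auto
  ultimately show ?thesis by (simp add: card_image)
qed

text \<open>The two arcs contribute \<open>c\<close> and the coincidences \<open>L1\<close> and
  \<open>L2\<close>; the edge \<open>y (i + c)\<close> at \<open>x (Suc i)\<close> and the edge
  \<open>y k\<close> at \<open>x (Suc k)\<close> fall outside the arc counts and add 2. An ear with
  two vertices or more excludes coincidences; for an ear with one vertex they are lost
  vertices.\<close>

lemma ear_degree_sum:
  assumes C: "cyc x y" and ear: "ear x y i k vs es f g" and ik: "i < k" "k < i + c"
  shows "dg (range y) (x (Suc i)) + dg (range y) (x (Suc k)) \<le> c + 3"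
proof -
  let ?u = "x (Suc i)" and ?v = "x (Suc k)"
  define L1 where "L1 = {b \<in> {Suc (Suc i)..k}. ?u \<in> y b \<and> ?v \<in> y (b - 1)}"
  define L2 where "L2 = {b \<in> {Suc (Suc k)..i + c}. ?v \<in> y b \<and> ?u \<in> y (b - 1)}"
  have ear': "ear x y k (i + c) (rev vs) (rev es) g f" by (rule ear_rev[OF C ear])
  have ik': "k < i + c" "i + c < k + c" using ik by auto
  have shift: "x (Suc (i + c)) = ?u" using cyc_period(1)[OF C, of "Suc i"] by simp
  have ne: "vs \<noteq> []" and lenes: "length vs = Suc (length es)"
    using ear by (auto simp: ear_def path_def bpath_def)
  have "card L1 + card L2 \<le> 1"
  proof (cases "length vs = 1")
    case False
    have two: "1 < length vs" using False ne by (cases vs) auto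
    have "b \<notin> L1" for b
      using ear_crossing[OF C ear ik, of "b - 1" b] two by (auto simp: L1_def less_diff_conv)
    moreover have "b \<notin> L2" for b
      using ear_crossing[OF C ear' ik', of "b - 1" b] two shift by (auto simp: L2_def less_diff_conv)
    ultimately have "L1 = {}" "L2 = {}" by blast+
    then show ?thesis by simp
  next
    case True
    let ?vs = "map x [Suc i..<Suc k] @ rev vs @ rev (map x [Suc k..<Suc (i + c)])"
    let ?es = "map y [Suc i..<k] @ g # rev es @ f # rev (map y [Suc k..<i + c])"
    let ?vs' = "map x [Suc k..<Suc (i + c)] @ rev (rev vs) @ rev (map x [Suc (i + c)..<Suc (k + c)])"
    let ?es' = "map y [Suc k..<i + c] @ f # rev (rev es) @ g # rev (map y [Suc (i + c)..<k + c])"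
    note P = ear_path[OF C ear ik]
    have sh: "map x [Suc (i + c)..<Suc (k + c)] = map x [Suc i..<Suc k]"
      "map y [Suc (i + c)..<k + c] = map y [Suc i..<k]"
      using cyc_period[OF C, of "Suc i + j" for j]
      by (auto intro!: nth_equalityI simp: ac_simps simp del: upt_Suc)
    \<comment> \<open>The reversed ear yields the same path read backwards. So the coincidences on
      both arcs are lost vertices of one path, which has at most one.\<close>
    have rv: "?vs' = rev ?vs" "?es' = rev ?es" unfolding sh by simp_all
    have leq: "lost ?vs' ?es' = lost ?vs ?es"
      unfolding rv by (rule lost_rev) (use P(1) in \<open>simp only: path_def bpath_def\<close>)
    have "x ` L1 \<subseteq> lost ?vs ?es"
      using ear_lost[OF C ear ik] by (auto simp: L1_def simp del: upt_Suc)
    moreover have "x ` L2 \<subseteq> lost ?vs' ?es'"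
      using ear_lost[OF C ear' ik'] shift by (auto simp: L2_def simp del: upt_Suc)
    ultimately have "card (x ` (L1 \<union> L2)) \<le> card (lost ?vs ?es)"
      unfolding leq by (intro card_mono finite_lost) blast
    also have "\<dots> \<le> 1" using card_lost_le_1[OF P(1)] P(4) True by simp
    finally have "card (x ` (L1 \<union> L2)) \<le> 1" .
    moreover have "inj_on x (L1 \<union> L2)"
      using ik by (auto simp: inj_on_def L1_def L2_def cyc_inj(1)[OF C])
    moreover have "card (L1 \<union> L2) = card L1 + card L2"
      by (intro card_Un_disjoint) (auto simp: L1_def L2_def)
    ultimately show ?thesis by (simp add: card_image)
  qed
  moreover have "card {b \<in> {Suc i..k}. ?u \<in> y b} + card {b \<in> {Suc i..<k}. ?v \<in> y b} \<le> (k - i) + card L1"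
    unfolding L1_def by (rule arc_count[OF ik(1)])
  moreover have "card {b \<in> {Suc k..i + c}. ?v \<in> y b} + card {b \<in> {Suc k..<i + c}. ?u \<in> y b} \<le> (i + c - k) + card L2"
    unfolding L2_def by (rule arc_count[OF ik(2)])
  moreover have "dg (range y) ?u \<le> card {b \<in> {Suc i..k}. ?u \<in> y b} + card {b \<in> {Suc k..<i + c}. ?u \<in> y b} + 1"
  proof -
    have "{j \<in> {Suc i..<Suc i + c}. ?u \<in> y j} \<subseteq>
      insert (i + c) ({b \<in> {Suc i..k}. ?u \<in> y b} \<union> {b \<in> {Suc k..<i + c}. ?u \<in> y b})"
      by auto
    then have "dg (range y) ?u \<le> card (insert (i + c) ({b \<in> {Suc i..k}. ?u \<in> y b} \<union> {b \<in> {Suc k..<i + c}. ?u \<in> y b}))"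
      unfolding dg_range[OF C, of ?u "Suc i"] by (intro card_mono) auto
    also have "\<dots> \<le> Suc (card ({b \<in> {Suc i..k}. ?u \<in> y b} \<union> {b \<in> {Suc k..<i + c}. ?u \<in> y b}))"
      by (rule card_insert_le_m1) auto
    finally show ?thesis
      using card_Un_le[of "{b \<in> {Suc i..k}. ?u \<in> y b}" "{b \<in> {Suc k..<i + c}. ?u \<in> y b}"] by linarith
  qed
  moreover have "dg (range y) ?v \<le> card {b \<in> {Suc i..<k}. ?v \<in> y b} + card {b \<in> {Suc k..i + c}. ?v \<in> y b} + 1"
  proof -
    have "{j \<in> {Suc i..<Suc i + c}. ?v \<in> y j} \<subseteq>
      insert k ({b \<in> {Suc i..<k}. ?v \<in> y b} \<union> {b \<in> {Suc k..i + c}. ?v \<in> y b})"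
      by auto
    then have "dg (range y) ?v \<le> card (insert k ({b \<in> {Suc i..<k}. ?v \<in> y b} \<union> {b \<in> {Suc k..i + c}. ?v \<in> y b}))"
      unfolding dg_range[OF C, of ?v "Suc i"] by (intro card_mono) auto
    also have "\<dots> \<le> Suc (card ({b \<in> {Suc i..<k}. ?v \<in> y b} \<union> {b \<in> {Suc k..i + c}. ?v \<in> y b}))"
      by (rule card_insert_le_m1) auto
    finally show ?thesis
      using card_Un_le[of "{b \<in> {Suc i..<k}. ?v \<in> y b}" "{b \<in> {Suc k..i + c}. ?v \<in> y b}"] by linarith
  qed
  ultimately show ?thesis using ik by linarith
qed

end

section \<open>Three long ears\<close>

text \<open>Labels P < Q < R on consecutive positions such that nearby positions carry increasing labels:
  up to a total excess of 2, there is one label per position, because a restart at a smaller label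
  costs two empty positions.\<close>

lemma monotone_labels_count:
  fixes P Q R :: "nat \<Rightarrow> bool"
  assumes "l \<le> r"
    and dec: "\<And>a b. l < a \<Longrightarrow> a < b \<Longrightarrow> b \<le> a + 2 \<Longrightarrow> b \<le> r \<Longrightarrow>
      \<not> (Q a \<and> P b) \<and> \<not> (R a \<and> P b) \<and> \<not> (R a \<and> Q b)"
  shows "card {j \<in> {Suc l..r}. P j} + card {j \<in> {Suc l..r}. Q j} + card {j \<in> {Suc l..r}. R j} \<le> (r - l) + 2"
proof -
  define N where "N k = card {j \<in> {Suc l..k}. P j} + card {j \<in> {Suc l..k}. Q j} + card {j \<in> {Suc l..k}. R j}" for k
  define ne where "ne j \<longleftrightarrow> l < j \<and> (P j \<or> Q j \<or> R j)" for j
  define top :: "nat \<Rightarrow> nat" where "top j = (if R j then 2 else if Q j then 1 else 0)" for j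
  have step: "card {j \<in> {Suc l..Suc k}. S j} = card {j \<in> {Suc l..k}. S j} + (if S (Suc k) then 1 else 0)"
    if "l \<le> k" for S k
  proof -
    have "{j \<in> {Suc l..Suc k}. S j} = (if S (Suc k) then insert (Suc k) {j \<in> {Suc l..k}. S j} else {j \<in> {Suc l..k}. S j})"
      using that by (auto simp: le_Suc_eq)
    then show ?thesis by simp
  qed
  have Nstep: "N (Suc k) = N k + (if P (Suc k) then 1 else 0) + (if Q (Suc k) then 1 else 0) + (if R (Suc k) then 1 else 0)"
    if "l \<le> k" for k
    using step[OF that] by (simp add: N_def)
  \<comment> \<open>Invariant for the excess over one label per position: at most the rank of the
    largest label at an occupied position, one less than the last rank after one empty position, and
    zero after two, which pays for a restart.\<close>
  have "k \<le> r \<Longrightarrow> (ne k \<longrightarrow> N k \<le> (k - l) + top k) \<and>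
    (\<not> ne k \<and> ne (k - 1) \<longrightarrow> N k + 1 \<le> (k - l) + top (k - 1)) \<and>
    (\<not> ne k \<and> \<not> ne (k - 1) \<longrightarrow> N k \<le> k - l)" if "l \<le> k" for k
    using that
  proof (induction k rule: dec_induct)
    case base
    have "N l = 0" by (simp add: N_def)
    then show ?case by (auto simp: ne_def)
  next
    case (step k)
    have d1: "ne k \<Longrightarrow> \<not> (Q k \<and> P (Suc k)) \<and> \<not> (R k \<and> P (Suc k)) \<and> \<not> (R k \<and> Q (Suc k))"
      using dec[of k "Suc k"] step by (auto simp: ne_def)
    have d2: "ne (k - 1) \<Longrightarrow> \<not> (Q (k - 1) \<and> P (Suc k)) \<and> \<not> (R (k - 1) \<and> P (Suc k)) \<and> \<not> (R (k - 1) \<and> Q (Suc k))"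
      using dec[of "k - 1" "Suc k"] step by (auto simp: ne_def)
    have sub: "Suc k - l = Suc (k - l)" using step by simp
    have neS: "ne (Suc k) \<longleftrightarrow> P (Suc k) \<or> Q (Suc k) \<or> R (Suc k)" using step by (simp add: ne_def)
    note IH = step.IH[OF Suc_leD[OF step.prems]]
    show ?case
    proof (cases "ne k")
      case True
      then have "P k \<or> Q k \<or> R k" by (simp add: ne_def)
      then show ?thesis using IH True d1 Nstep[OF step(1)] neS sub
        by (auto simp: top_def split: if_splits)
    next
      case False
      show ?thesis
      proof (cases "ne (k - 1)")
        case True
        then have "P (k - 1) \<or> Q (k - 1) \<or> R (k - 1)" by (simp add: ne_def)
        then show ?thesis using IH True False d2 Nstep[OF step(1)] neS sub
          by (auto simp: top_def split: if_splits)
      next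
        case False
        then show ?thesis using IH \<open>\<not> ne k\<close> Nstep[OF step(1)] neS sub
          by (auto simp: top_def split: if_splits)
      qed
    qed
  qed
  from this[OF assms(1)] have "N r \<le> (r - l) + 2"
    by (auto simp: top_def split: if_splits)
  then show ?thesis by (simp add: N_def)
qed

context longest_cycle begin

text \<open>The labels in increasing order are the successors of \<open>x i\<close>,
  \<open>x k\<close> and \<open>x j\<close>. An ear with three vertices excludes crossings at
  distances 1 and 2, exactly the range in which labels must not decrease. The pair of
  \<open>j\<close> and \<open>k\<close> is read off the reversed ear.\<close>

lemma long_ears_arc_count:
  assumes C: "cyc x y" and i: "i < j" "j < k" "k < i + c"
    and ij: "ear x y i j vs es f g" "3 \<le> length vs"
    and ik: "ear x y i k vs' es' f' g'" "3 \<le> length vs'"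
    and jk: "ear x y j k vs'' es'' f'' g''" "3 \<le> length vs''"
  shows "card {b \<in> {Suc i..j}. x (Suc i) \<in> y b} + card {b \<in> {Suc i..j}. x (Suc k) \<in> y b}
    + card {b \<in> {Suc i..j}. x (Suc j) \<in> y b} \<le> (j - i) + 2"
proof (rule monotone_labels_count)
  fix a b assume ab: "i < a" "a < b" "b \<le> a + 2" "b \<le> j"
  have "\<not> (x (Suc k) \<in> y a \<and> x (Suc i) \<in> y b)"
    using ear_crossing[OF C ik(1), of a b] ab i ik(2) by auto
  moreover have "\<not> (x (Suc j) \<in> y a \<and> x (Suc i) \<in> y b)"
    using ear_crossing[OF C ij(1), of a b] ab i ij(2) by auto
  moreover have "\<not> (x (Suc j) \<in> y a \<and> x (Suc k) \<in> y b)"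
    using ear_crossing[OF C ear_rev[OF C jk(1)], of "a + c" "b + c"] ab i jk(2)
      cyc_period[OF C, of a] cyc_period[OF C, of b] cyc_period(1)[OF C, of "Suc j"] by auto
  ultimately show "\<not> (x (Suc k) \<in> y a \<and> x (Suc i) \<in> y b) \<and> \<not> (x (Suc j) \<in> y a \<and> x (Suc i) \<in> y b) \<and>
    \<not> (x (Suc j) \<in> y a \<and> x (Suc k) \<in> y b)" by blast
qed (use i in simp)

text \<open>Each of the three arcs contributes its length and an excess of 2. Reversed ears bring
  every arc into the position of the one between \<open>i\<close> and \<open>j\<close>.\<close>

lemma long_ears_degree_sum:
  assumes C: "cyc x y" and i: "i < j" "j < k" "k < i + c"
    and ij: "ear x y i j vs es f g" "3 \<le> length vs"
    and ik: "ear x y i k vs' es' f' g'" "3 \<le> length vs'"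
    and jk: "ear x y j k vs'' es'' f'' g''" "3 \<le> length vs''"
  shows "dg (range y) (x (Suc i)) + dg (range y) (x (Suc j)) + dg (range y) (x (Suc k)) \<le> c + 6"
proof -
  let ?n = "\<lambda>v l r. card {b \<in> {Suc l..r}. v \<in> y b}"
  have sh: "x (Suc (i + c)) = x (Suc i)" "x (Suc (j + c)) = x (Suc j)"
    using cyc_period(1)[OF C, of "Suc i"] cyc_period(1)[OF C, of "Suc j"] by simp_all
  have 1: "?n (x (Suc i)) i j + ?n (x (Suc k)) i j + ?n (x (Suc j)) i j \<le> (j - i) + 2"
    by (rule long_ears_arc_count[OF C i ij ik jk])
  have 2: "?n (x (Suc j)) j k + ?n (x (Suc i)) j k + ?n (x (Suc k)) j k \<le> (k - j) + 2"
    using long_ears_arc_count[OF C _ _ _ jk ear_rev[OF C ij(1)] _ ear_rev[OF C ik(1)]] i ij ik jk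
    unfolding sh by simp
  have 3: "?n (x (Suc k)) k (i + c) + ?n (x (Suc j)) k (i + c) + ?n (x (Suc i)) k (i + c) \<le> (i + c - k) + 2"
    using long_ears_arc_count[OF C _ _ _ ear_rev[OF C ik(1)] _ ear_rev[OF C jk(1)] _ ear_rev[OF C ear_rev[OF C ij(1)]]] i ij ik jk
    unfolding sh by simp
  have split: "dg (range y) v \<le> ?n v i j + ?n v j k + ?n v k (i + c)" for v
  proof -
    have "{b \<in> {Suc i..<Suc i + c}. v \<in> y b} \<subseteq>
      {b \<in> {Suc i..j}. v \<in> y b} \<union> {b \<in> {Suc j..k}. v \<in> y b} \<union> {b \<in> {Suc k..i + c}. v \<in> y b}"
      by auto
    then have "dg (range y) v \<le> card ({b \<in> {Suc i..j}. v \<in> y b} \<union> {b \<in> {Suc j..k}. v \<in> y b} \<union> {b \<in> {Suc k..i + c}. v \<in> y b})"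
      unfolding dg_range[OF C, of v "Suc i"] by (intro card_mono) auto
    also have "\<dots> \<le> ?n v i j + ?n v j k + ?n v k (i + c)"
      by (intro order_trans[OF card_Un_le] add_mono card_Un_le order_refl)
    finally show ?thesis .
  qed
  show ?thesis using 1 2 3 split[of "x (Suc i)"] split[of "x (Suc j)"] split[of "x (Suc k)"] i by linarith
qed

end

section \<open>Gates of a component\<close>

lemma card_subsets_ge_2:
  assumes "finite T"
  shows "card {s \<in> Pow T. 2 \<le> card s} + 1 + card T = 2 ^ card T"
proof -
  let ?B = "insert {} ((\<lambda>t. {t}) ` T)"
  have "{s \<in> Pow T. 2 \<le> card s} \<inter> ?B = {}" by auto
  moreover have "Pow T \<subseteq> {s \<in> Pow T. 2 \<le> card s} \<union> ?B"
  proof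
    fix s assume s: "s \<in> Pow T"
    then have "finite s" using assms finite_subset by auto
    then have "card s = 0 \<longleftrightarrow> s = {}" "card s = 1 \<longleftrightarrow> (\<exists>t. s = {t})"
      by (auto simp: card_1_singleton_iff)
    then show "s \<in> {s \<in> Pow T. 2 \<le> card s} \<union> ?B" using s by (cases "card s" rule: nat.exhaust) fastforce+
  qed
  then have "Pow T = {s \<in> Pow T. 2 \<le> card s} \<union> ?B" by auto
  ultimately have "card (Pow T) = card {s \<in> Pow T. 2 \<le> card s} + card ?B"
    using assms by (metis (no_types, lifting) card_Un_disjoint finite_Pow_iff finite_Un)
  moreover have "card ?B = 1 + card T"
    using assms by (subst card_insert_disjoint) (auto simp: card_image)
  ultimately show ?thesis using card_Pow[OF assms] by simp
qed

context longest_cycle begin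

text \<open>The gates of a component are the vertices through which it must be left towards the cycle: a
  cycle vertex with several edges into the component, a component edge that is the only link of some
  cycle vertex, or a cycle edge that meets the component.\<close>

definition links :: "(nat \<Rightarrow> 'a) \<Rightarrow> (nat \<Rightarrow> 'a set) \<Rightarrow> 'a \<Rightarrow> 'a \<Rightarrow> 'a set set" where
  "links x y z v = {e \<in> comp_edges x y z. v \<in> e}"

definition gate_vertices :: "(nat \<Rightarrow> 'a) \<Rightarrow> (nat \<Rightarrow> 'a set) \<Rightarrow> 'a \<Rightarrow> 'a set" where
  "gate_vertices x y z = {v \<in> range x. 2 \<le> card (links x y z v)}"

definition gate_edges :: "(nat \<Rightarrow> 'a) \<Rightarrow> (nat \<Rightarrow> 'a set) \<Rightarrow> 'a \<Rightarrow> 'a set set" where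
  "gate_edges x y z = {e. \<exists>v\<in>range x. links x y z v = {e}}"

definition contact_edges :: "(nat \<Rightarrow> 'a) \<Rightarrow> (nat \<Rightarrow> 'a set) \<Rightarrow> 'a \<Rightarrow> 'a set set" where
  "contact_edges x y z = {e \<in> range y. e \<inter> comp x y z \<noteq> {}}"

definition gates :: "(nat \<Rightarrow> 'a) \<Rightarrow> (nat \<Rightarrow> 'a set) \<Rightarrow> 'a \<Rightarrow> ('a + 'a set) set" where
  "gates x y z = Inl ` gate_vertices x y z \<union> Inr ` (gate_edges x y z \<union> contact_edges x y z)"

fun connectors :: "(nat \<Rightarrow> 'a) \<Rightarrow> (nat \<Rightarrow> 'a set) \<Rightarrow> 'a \<Rightarrow> 'a + 'a set \<Rightarrow> 'a set set" where
  "connectors x y z (Inl v) = links x y z v"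
| "connectors x y z (Inr e) = {e}"

text \<open>A position where the gate meets the cycle and behind which no component edge touches it.
  The condition on the successor makes its edges disjoint from \<open>comp_edges\<close>.\<close>

definition gate_index :: "(nat \<Rightarrow> 'a) \<Rightarrow> (nat \<Rightarrow> 'a set) \<Rightarrow> 'a \<Rightarrow> 'a + 'a set \<Rightarrow> nat \<Rightarrow> bool" where
  "gate_index x y z \<gamma> i \<longleftrightarrow> i < c \<and> links x y z (x (Suc i)) = {} \<and>
     (\<gamma> = Inl (x i) \<or> (\<exists>e. \<gamma> = Inr e \<and> (e = y i \<or> links x y z (x i) = {e})))"

lemma finite_links: "finite (links x y z v)"
  using finite_E comp_edges_sub[of x y z] by (auto simp: links_def intro: finite_subset)

lemma gate_sets:
  assumes C: "cyc x y" and z: "z \<in> V - range x"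
  shows "gate_vertices x y z \<subseteq> range x" "gate_edges x y z \<subseteq> comp_edges x y z"
    "contact_edges x y z \<subseteq> range y" "finite (gate_vertices x y z)"
    "finite (gate_edges x y z)" "finite (contact_edges x y z)"
    "card (gates x y z) = card (gate_vertices x y z) + card (gate_edges x y z) + card (contact_edges x y z)"
proof -
  show s: "gate_vertices x y z \<subseteq> range x" "gate_edges x y z \<subseteq> comp_edges x y z"
    "contact_edges x y z \<subseteq> range y"
    by (auto simp: gate_vertices_def gate_edges_def contact_edges_def links_def)
  show f: "finite (gate_vertices x y z)" "finite (gate_edges x y z)" "finite (contact_edges x y z)"
    using s cyc_sub[OF C] finite_V finite_E comp_edges_sub[of x y z] by (meson finite_subset Diff_subset order_trans)+
  have "gate_edges x y z \<inter> contact_edges x y z = {}"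
    using s comp_edges_sub[of x y z] by blast
  then have "card (gate_edges x y z \<union> contact_edges x y z) = card (gate_edges x y z) + card (contact_edges x y z)"
    using f by (intro card_Un_disjoint)
  moreover have "card (gates x y z) = card (Inl ` gate_vertices x y z :: ('a + 'a set) set)
      + card (Inr ` (gate_edges x y z \<union> contact_edges x y z) :: ('a + 'a set) set)"
    unfolding gates_def using f by (intro card_Un_disjoint) auto
  ultimately show "card (gates x y z) = card (gate_vertices x y z) + card (gate_edges x y z) + card (contact_edges x y z)"
    by (simp add: card_image)
qed

lemma finite_gates: "cyc x y \<Longrightarrow> z \<in> V - range x \<Longrightarrow> finite (gates x y z)"
  using gate_sets(4-6)[of x y z] by (simp add: gates_def)

lemma gates_cover:
  assumes C: "cyc x y" and z: "z \<in> V - range x"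
  shows "v \<in> range x \<Longrightarrow> e \<in> links x y z v \<Longrightarrow> v \<in> gate_vertices x y z \<or> links x y z v = {e} \<and> e \<in> gate_edges x y z"
proof -
  assume v: "v \<in> range x" "e \<in> links x y z v"
  show ?thesis
  proof (cases "2 \<le> card (links x y z v)")
    case False
    moreover have "card (links x y z v) \<noteq> 0" using v finite_links by auto
    ultimately have "card (links x y z v) = 1" by linarith
    then have "links x y z v = {e}" using v by (auto simp: card_1_singleton_iff)
    then show ?thesis using v by (auto simp: gate_edges_def)
  qed (use v in \<open>auto simp: gate_vertices_def\<close>)
qed

text \<open>The gates cut the component off from the cycle. Two of them could do so only by
  containing the whole cycle, which has at least two vertices and two edges.\<close>

lemma card_gates_ge_3:
  assumes C: "cyc x y" and z: "z \<in> V - range x"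
  shows "3 \<le> card (gates x y z)"
proof (rule ccontr)
  assume small: "\<not> 3 \<le> card (gates x y z)"
  let ?K = "comp x y z" and ?L = "comp_edges x y z"
  let ?X = "gate_vertices x y z" and ?G = "gate_edges x y z" and ?Y = "contact_edges x y z"
  note G = gate_sets[OF C z]
  have K: "?K \<subseteq> V - range x" by (rule comp_sub[OF z])
  have "card (?G \<union> ?Y) \<le> card ?G + card ?Y" by (rule card_Un_le)
  then have sz: "card ?X + card (?G \<union> ?Y) \<le> 2" using small G(7) by linarith
  have "V \<subseteq> ?K \<union> ?X \<and> E \<subseteq> (?L - ?G) \<union> (?G \<union> ?Y)"
  proof (rule cut[of ?X "?G \<union> ?Y" ?K "?L - ?G"])
    show "?X \<subseteq> V" "?G \<union> ?Y \<subseteq> E" "?K \<subseteq> V" "?L - ?G \<subseteq> E"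
      using G(1-3) cyc_sub(1,2)[OF C] K comp_edges_sub[of x y z] by blast+
    show "?K \<inter> ?X = {}" "(?L - ?G) \<inter> (?G \<union> ?Y) = {}"
      using G(1-3) K comp_edges_sub[of x y z] by blast+
    show "?K \<noteq> {} \<or> ?L - ?G \<noteq> {}" using comp_self[of z] by blast
    show "e \<in> (?L - ?G) \<union> (?G \<union> ?Y)" if "v \<in> ?K" "e \<in> E" "v \<in> e" for v e
      using that edge_in_comp_edges[of v x y z e] by (auto simp: contact_edges_def)
    show "v \<in> ?K \<union> ?X" if ve: "e \<in> ?L - ?G" "v \<in> e" for v e
    proof (cases "v \<in> range x")
      case True
      then show ?thesis using gates_cover[OF C z, of v e] ve by (auto simp: links_def)
    next
      case False
      obtain p where "p \<in> ?K" "p \<in> e" "e \<in> E - range y" using ve by (auto simp: comp_edges_def)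
      then show ?thesis using comp_closed[OF z, of p y e v] False ve by blast
    qed
  qed (rule sz)
  then have cover: "V \<subseteq> ?K \<union> ?X" "E \<subseteq> ?L \<union> ?Y" using G(2) by auto
  have "range x \<subseteq> ?X"
  proof
    fix v assume v: "v \<in> range x"
    then have "v \<in> V" "v \<notin> ?K" using cyc_sub(1)[OF C] K by auto
    then show "v \<in> ?X" using cover(1) by auto
  qed
  moreover have "range y \<subseteq> ?Y"
  proof
    fix e assume e: "e \<in> range y"
    then have "e \<in> E" "e \<notin> ?L" using cyc_sub(2)[OF C] comp_edges_sub[of x y z] by auto
    then show "e \<in> ?Y" using cover(2) by auto
  qed
  ultimately have "c \<le> card ?X" "c \<le> card ?Y"
    using card_mono[OF G(4), of "range x"] card_mono[OF G(6), of "range y"] card_ranges[OF C] by simp_all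
  moreover have "card ?X + card ?Y \<le> 2" using small G(7) by linarith
  ultimately show False using c_ge_2 by linarith
qed

lemma connectors_nonempty: "\<gamma> \<in> gates x y z \<Longrightarrow> connectors x y z \<gamma> \<noteq> {}"
  by (cases \<gamma>) (auto simp: gates_def gate_vertices_def)

text \<open>A gate vertex has two connectors, so one of them differs from any given edge; gate edges
  and contact edges are their own connectors.\<close>

lemma distinct_connectors:
  assumes "\<gamma> \<in> gates x y z" "\<gamma>' \<in> gates x y z" "\<gamma> \<noteq> \<gamma>'"
  shows "\<exists>f\<in>connectors x y z \<gamma>. \<exists>g\<in>connectors x y z \<gamma>'. f \<noteq> g"
proof -
  have two: "\<exists>f\<in>links x y z v. f \<noteq> g" if "Inl v \<in> gates x y z" for v g
  proof (rule ccontr)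
    assume "\<not> ?thesis"
    then have "links x y z v \<subseteq> {g}" by blast
    then have "card (links x y z v) \<le> 1" using card_mono[of "{g}"] by simp
    then show False using that by (auto simp: gates_def gate_vertices_def)
  qed
  obtain g where g: "g \<in> connectors x y z \<gamma>'" using connectors_nonempty assms by blast
  obtain f where f: "f \<in> connectors x y z \<gamma>" using connectors_nonempty assms by blast
  show ?thesis
  proof (cases \<gamma>)
    case (Inl v)
    then show ?thesis using two[of v g] assms g by auto
  next
    case (Inr e)
    show ?thesis
    proof (cases \<gamma>')
      case (Inl v)
      then show ?thesis using two[of v f] assms f by fastforce
    next
      case (Inr e')
      then show ?thesis using \<open>\<gamma> = Inr e\<close> assms by simp
    qed
  qed
qed

text \<open>For a gate vertex or a contact edge, a link at the successor would allow an insertion. A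
  gate edge may be the only link along a run of cycle vertices, and the end of the run is taken. A
  run all around the cycle would leave a single gate.\<close>

lemma gate_index_ex:
  assumes C: "cyc x y" and z: "z \<in> V - range x" and \<gamma>: "\<gamma> \<in> gates x y z"
  shows "\<exists>i. gate_index x y z \<gamma> i"
proof -
  have red: "gate_index x y z \<gamma> (i mod c)"
    if "links x y z (x (Suc i)) = {}" "\<gamma> = Inl (x i) \<or> (\<exists>e. \<gamma> = Inr e \<and> (e = y i \<or> links x y z (x i) = {e}))" for i
  proof -
    have "x (Suc (i mod c)) = x (Suc i)"
      using cyc_mod[OF C, of "Suc (i mod c)"] cyc_mod[OF C, of "Suc i"] by (simp add: mod_Suc_eq)
    then show ?thesis using that cyc_mod[OF C, of i] c_ge_2 by (simp add: gate_index_def)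
  qed
  have meets: "f \<inter> comp x y z \<noteq> {}" if "f \<in> comp_edges x y z" for f
    using that by (auto simp: comp_edges_def)
  have step: "f = g" if "f \<in> comp_edges x y z \<or> f = y i \<and> y i \<inter> comp x y z \<noteq> {}" "x i \<in> f"
    "g \<in> comp_edges x y z \<or> g = y i \<and> y i \<inter> comp x y z \<noteq> {}" "x (Suc i) \<in> g" for f g i
    using no_insertion[OF C z, of f i g] that meets by blast
  consider v where "\<gamma> = Inl v" "v \<in> gate_vertices x y z" | e where "\<gamma> = Inr e" "e \<in> contact_edges x y z"
    | e where "\<gamma> = Inr e" "e \<in> gate_edges x y z"
    using \<gamma> by (auto simp: gates_def)
  then show ?thesis
  proof cases
    case 1
    then obtain i where i: "v = x i" by (auto simp: gate_vertices_def)
    have "links x y z (x (Suc i)) = {}"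
    proof (rule ccontr)
      assume "\<not> ?thesis"
      then obtain g where g: "g \<in> comp_edges x y z" "x (Suc i) \<in> g" by (auto simp: links_def)
      then have "links x y z v \<subseteq> {g}" using step[of _ i g] i by (auto simp: links_def)
      then have "card (links x y z v) \<le> 1" using card_mono[of "{g}"] by simp
      then show False using 1 by (simp add: gate_vertices_def)
    qed
    then show ?thesis using red[of i] 1 i by blast
  next
    case 2
    then obtain i where i: "e = y i" "y i \<inter> comp x y z \<noteq> {}" by (auto simp: contact_edges_def)
    have "links x y z (x (Suc i)) = {}"
      using step[of "y i" i] i cyc_inc[OF C, of i] comp_edges_sub[of x y z] by (fastforce simp: links_def)
    then show ?thesis using red[of i] 2 i by blast
  next
    case 3
    have "\<exists>i. links x y z (x i) = {e} \<and> links x y z (x (Suc i)) \<noteq> {e}"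
    proof (rule ccontr)
      assume no: "\<not> ?thesis"
      obtain i where i: "links x y z (x i) = {e}" using 3 by (auto simp: gate_edges_def)
      have "links x y z (x (i + d)) = {e}" for d
        by (induction d) (use i no in auto)
      then have all: "links x y z v = {e}" if "v \<in> range x" for v
        using that cyc_window[OF C, of i] by (metis imageE le_Suc_ex atLeastLessThan_iff)
      have "gate_vertices x y z = {}" using all by (auto simp: gate_vertices_def)
      moreover have "gate_edges x y z \<subseteq> {e}" using all by (auto simp: gate_edges_def)
      moreover have "contact_edges x y z = {}"
      proof (rule ccontr)
        assume "\<not> ?thesis"
        then obtain j where j: "y j \<inter> comp x y z \<noteq> {}" by (auto simp: contact_edges_def)
        have "e \<in> comp_edges x y z" "x j \<in> e" using all[of "x j"] by (auto simp: links_def)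
        then show False using step[of e j "y j"] j cyc_inc[OF C, of j] comp_edges_sub[of x y z] by auto
      qed
      ultimately have "card (gates x y z) \<le> 1"
        using gate_sets(7)[OF C z] card_mono[of "{e}" "gate_edges x y z"] by simp
      then show False using card_gates_ge_3[OF C z] by simp
    qed
    then obtain i where i: "links x y z (x i) = {e}" "links x y z (x (Suc i)) \<noteq> {e}" by blast
    then have e: "e \<in> comp_edges x y z" "x i \<in> e" by (auto simp: links_def)
    have "links x y z (x (Suc i)) \<subseteq> {e}"
      using step[of e i] e by (auto simp: links_def)
    then have "links x y z (x (Suc i)) = {}" using i by blast
    then show ?thesis using red[of i] 3 i by blast
  qed
qed

lemma gate_index_connectors:
  assumes C: "cyc x y" and z: "z \<in> V - range x" and \<gamma>: "\<gamma> \<in> gates x y z" and i: "gate_index x y z \<gamma> i"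
    and f: "f \<in> connectors x y z \<gamma>"
  shows "x i \<in> f" "f \<inter> comp x y z \<noteq> {}" "f \<in> comp_edges x y z \<or> f = y i"
proof -
  have "(f \<in> links x y z (x i)) \<or> (f = y i \<and> \<gamma> = Inr f)"
    using i f by (auto simp: gate_index_def)
  moreover have "f \<inter> comp x y z \<noteq> {}" if "\<gamma> = Inr f"
    using that \<gamma> gate_sets(2)[OF C z] by (auto simp: gates_def contact_edges_def comp_edges_def)
  ultimately show "x i \<in> f" "f \<inter> comp x y z \<noteq> {}" "f \<in> comp_edges x y z \<or> f = y i"
    using cyc_inc[OF C, of i] by (auto simp: links_def comp_edges_def)
qed

text \<open>If \<open>y i\<close> is a connector, \<open>no_insertion\<close> excludes any other
  connector at \<open>x i\<close>. So both gates arise from the links of \<open>x i\<close>, and the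
  number of links determines which gate it is.\<close>

lemma gate_index_inj:
  assumes C: "cyc x y" and z: "z \<in> V - range x" and g: "\<gamma> \<in> gates x y z" "\<gamma>' \<in> gates x y z"
    and i: "gate_index x y z \<gamma> i" "gate_index x y z \<gamma>' i"
  shows "\<gamma> = \<gamma>'"
proof (rule ccontr)
  assume ne: "\<gamma> \<noteq> \<gamma>'"
  obtain f h where fh: "f \<in> connectors x y z \<gamma>" "h \<in> connectors x y z \<gamma>'" "f \<noteq> h"
    using distinct_connectors[OF g ne] by blast
  note F = gate_index_connectors[OF C z g(1) i(1) fh(1)]
  note H = gate_index_connectors[OF C z g(2) i(2) fh(2)]
  have "f \<noteq> y i" using no_insertion[OF C z, of h i f] F H fh cyc_inc[OF C, of i] by blast
  moreover have "h \<noteq> y i" using no_insertion[OF C z, of f i h] F H fh cyc_inc[OF C, of i] by blast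
  moreover have "2 \<le> card (links x y z v)" if "Inl v \<in> gates x y z" for v
    using that by (auto simp: gates_def gate_vertices_def)
  ultimately show False using i fh ne g
    by (auto simp: gate_index_def)
qed

lemma gate_ear:
  assumes C: "cyc x y" and z: "z \<in> V - range x" and g: "\<gamma> \<in> gates x y z" "\<gamma>' \<in> gates x y z"
    and i: "gate_index x y z \<gamma> i" "gate_index x y z \<gamma>' k" and ne: "\<gamma> \<noteq> \<gamma>'"
  obtains vs es f h where "ear x y i k vs es f h" "set es \<union> {f, h} \<subseteq> comp_edges x y z \<union> range y"
proof -
  obtain f h where fh: "f \<in> connectors x y z \<gamma>" "h \<in> connectors x y z \<gamma>'" "f \<noteq> h"
    using distinct_connectors[OF g ne] by blast
  note F = gate_index_connectors[OF C z g(1) i(1) fh(1)]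
  note H = gate_index_connectors[OF C z g(2) i(2) fh(2)]
  obtain vs es where P: "path vs es" "set vs \<subseteq> comp x y z" "set es \<subseteq> comp_edges x y z"
    "hd vs \<in> f" "last vs \<in> h" "f \<notin> set es" "h \<notin> set es"
    "set vs \<inter> range x = {}" "set es \<inter> range y = {}" "vs \<noteq> []"
    by (rule comp_ear_path[OF C z F(2) H(2)])
  have "f \<in> E" "h \<in> E" "f \<notin> range y \<or> f = y i" "h \<notin> range y \<or> h = y k"
    using F(3) H(3) cyc_sub(4)[OF C] comp_edges_sub[of x y z] by blast+
  then have "ear x y i k vs es f h" unfolding ear_def using P F(1) H(1) fh(3) by blast
  moreover have "set es \<union> {f, h} \<subseteq> comp_edges x y z \<union> range y" using P(3) F(3) H(3) by blast
  ultimately show thesis by (rule that)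
qed

text \<open>By \<open>ear_outer\<close> a common edge of two successors off the cycle belongs to the
  ear joining their gates, hence to \<open>comp_edges\<close>, which \<open>gate_index\<close> rules
  out. So the successors and the component own disjoint blocks.\<close>

lemma gate_count:
  assumes C: "cyc x y" and z: "z \<in> V - range x" and \<Gamma>: "\<Gamma> \<subseteq> gates x y z"
    and ix: "\<And>\<gamma>. \<gamma> \<in> \<Gamma> \<Longrightarrow> gate_index x y z \<gamma> (ix \<gamma>)"
  shows "card \<Gamma> * \<delta> + card (comp_edges x y z) + c
    \<le> card E + (\<Sum>\<gamma>\<in>\<Gamma>. dg (range y) (x (Suc (ix \<gamma>))))"
proof -
  let ?u = "\<lambda>\<gamma>. x (Suc (ix \<gamma>))"
  have lt: "ix \<gamma> < c" if "\<gamma> \<in> \<Gamma>" for \<gamma> using ix[OF that] by (simp add: gate_index_def)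
  have inj: "inj_on ?u \<Gamma>"
  proof (rule inj_onI)
    fix \<gamma> \<gamma>' assume g: "\<gamma> \<in> \<Gamma>" "\<gamma>' \<in> \<Gamma>" "?u \<gamma> = ?u \<gamma>'"
    then have "ix \<gamma> = ix \<gamma>'" using cyc_inj(1)[OF C, of "Suc (ix \<gamma>)" "Suc (ix \<gamma>')"] lt[of \<gamma>] lt[of \<gamma>'] by simp
    then show "\<gamma> = \<gamma>'" using gate_index_inj[OF C z, of \<gamma> \<gamma>' "ix \<gamma>"] ix[of \<gamma>] ix[of \<gamma>'] g \<Gamma> by auto
  qed
  have noL: "outer (range y) (?u \<gamma>) \<inter> comp_edges x y z = {}" if "\<gamma> \<in> \<Gamma>" for \<gamma>
    using ix[OF that] by (auto simp: gate_index_def links_def outer_def)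
  have lts: "outer (range y) (?u \<gamma>) \<inter> outer (range y) (?u \<gamma>') = {}"
    if g: "\<gamma> \<in> \<Gamma>" "\<gamma>' \<in> \<Gamma>" and l: "ix \<gamma> < ix \<gamma>'" for \<gamma> \<gamma>'
  proof -
    obtain vs es f h where e: "ear x y (ix \<gamma>) (ix \<gamma>') vs es f h" "set es \<union> {f, h} \<subseteq> comp_edges x y z \<union> range y"
      by (rule gate_ear[OF C z, of \<gamma> \<gamma>' "ix \<gamma>" "ix \<gamma>'"]) (use g \<Gamma> ix l in auto)
    have "outer (range y) (?u \<gamma>) \<inter> outer (range y) (?u \<gamma>') \<subseteq> set es \<union> {f, h}"
      using ear_outer[OF C e(1) l] lt[OF g(2)] by simp
    then show ?thesis using e(2) noL[OF g(1)] by (auto simp: outer_def)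
  qed
  have "card (?u ` \<Gamma>) * \<delta> + card (comp_edges x y z) + card (range y) \<le> card E + (\<Sum>v\<in>?u ` \<Gamma>. dg (range y) v)"
  proof (rule outer_count)
    show "?u ` \<Gamma> \<subseteq> V" using cyc_sub[OF C] by auto
    show "range y \<subseteq> E" by (rule cyc_sub[OF C])
    show "comp_edges x y z \<subseteq> E - range y" by (rule comp_edges_sub)
    show "outer (range y) u \<inter> comp_edges x y z = {}" if "u \<in> ?u ` \<Gamma>" for u using noL that by blast
    fix u v assume "u \<in> ?u ` \<Gamma>" "v \<in> ?u ` \<Gamma>" "u \<noteq> v"
    then obtain \<gamma> \<gamma>' where g: "\<gamma> \<in> \<Gamma>" "\<gamma>' \<in> \<Gamma>" "u = ?u \<gamma>" "v = ?u \<gamma>'" by blast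
    moreover have "ix \<gamma> \<noteq> ix \<gamma>'" using g(3,4) \<open>u \<noteq> v\<close> by auto
    ultimately show "outer (range y) u \<inter> outer (range y) v = {}"
      using lts[of \<gamma> \<gamma>'] lts[of \<gamma>' \<gamma>] by (metis Int_commute linorder_neqE_nat)
  qed
  then show ?thesis using inj card_ranges[OF C] by (simp add: card_image sum.reindex)
qed

lemma gate_degree_sum:
  assumes C: "cyc x y" and z: "z \<in> V - range x" and g: "\<gamma> \<in> gates x y z" "\<gamma>' \<in> gates x y z" "\<gamma> \<noteq> \<gamma>'"
    and i: "gate_index x y z \<gamma> i" "gate_index x y z \<gamma>' k"
  shows "dg (range y) (x (Suc i)) + dg (range y) (x (Suc k)) \<le> c + 3"
proof -
  have lt: "i < c" "k < c" using i by (auto simp: gate_index_def)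
  have "i \<noteq> k" using gate_index_inj[OF C z g(1,2)] i g(3) by blast
  then consider "i < k" | "k < i" by linarith
  then show ?thesis
  proof cases
    case 1
    obtain vs es f h where "ear x y i k vs es f h"
      by (rule gate_ear[OF C z g(1,2) i g(3)])
    then show ?thesis using ear_degree_sum[OF C _ 1] lt by simp
  next
    case 2
    obtain vs es f h where "ear x y k i vs es f h"
      by (rule gate_ear[OF C z g(2,1) i(2,1) g(3)[symmetric]])
    then show ?thesis using ear_degree_sum[OF C _ 2] lt by (simp add: add.commute)
  qed
qed

lemma card_links_ge:
  assumes C: "cyc x y" and z: "z \<in> V - range x" and p: "p \<in> comp x y z"
  shows "\<delta> \<le> card (links x y z p) + dg (range y) p" "\<delta> \<le> card (links x y z p) + 3"
proof -
  have pV: "p \<in> V - range x" using comp_sub[OF z] p by blast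
  have "outer (range y) p \<subseteq> links x y z p"
    using edge_in_comp_edges[OF p] by (auto simp: outer_def links_def)
  then have "card (outer (range y) p) \<le> card (links x y z p)" by (intro card_mono finite_links)
  moreover have "\<delta> \<le> card (outer (range y) p) + dg (range y) p"
    using card_outer pV cyc_sub[OF C] by blast
  ultimately show 1: "\<delta> \<le> card (links x y z p) + dg (range y) p" by linarith
  then show "\<delta> \<le> card (links x y z p) + 3" using outside_degree_le[OF C pV] by linarith
qed

lemma card_comp_edges_ge:
  assumes "cyc x y" "z \<in> V - range x"
  shows "\<delta> \<le> card (comp_edges x y z) + dg (range y) z" "\<delta> \<le> card (comp_edges x y z) + 3"
proof -
  have "card (links x y z z) \<le> card (comp_edges x y z)"
    using comp_edges_sub[of x y z] finite_E
    by (intro card_mono) (auto simp: links_def intro: finite_subset)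
  then show "\<delta> \<le> card (comp_edges x y z) + dg (range y) z" "\<delta> \<le> card (comp_edges x y z) + 3"
    using card_links_ge[OF assms comp_self] by linarith+
qed

text \<open>Four successors form two pairs, each with cycle degree sum at most \<open>c + 3\<close>.
  With at least \<open>\<delta> - 3\<close> component edges the edge count would give
  \<open>\<delta> < c\<close>.\<close>

lemma card_gates_eq_3:
  assumes C: "cyc x y" and z: "z \<in> V - range x"
  shows "card (gates x y z) = 3"
proof (rule ccontr)
  assume "card (gates x y z) \<noteq> 3"
  then have "4 \<le> card (gates x y z)" using card_gates_ge_3[OF C z] by linarith
  then obtain \<Gamma> where \<Gamma>: "\<Gamma> \<subseteq> gates x y z" "card \<Gamma> = 4" by (meson obtain_subset_with_card_n)
  obtain ix where ix: "\<And>\<gamma>. \<gamma> \<in> gates x y z \<Longrightarrow> gate_index x y z \<gamma> (ix \<gamma>)"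
    using gate_index_ex[OF C z] by metis
  obtain p q r s where G: "\<Gamma> = {p, q, r, s}" "distinct [p, q, r, s]"
    using \<Gamma>(2) by (auto simp: card_Suc_eq numeral_eq_Suc)
  let ?d = "\<lambda>\<gamma>. dg (range y) (x (Suc (ix \<gamma>)))"
  have pr: "?d \<gamma> + ?d \<gamma>' \<le> c + 3" if "\<gamma> \<in> \<Gamma>" "\<gamma>' \<in> \<Gamma>" "\<gamma> \<noteq> \<gamma>'" for \<gamma> \<gamma>'
    using gate_degree_sum[OF C z _ _ that(3) ix ix] that \<Gamma>(1) by blast
  have "4 * \<delta> + card (comp_edges x y z) + c \<le> card E + (\<Sum>\<gamma>\<in>\<Gamma>. ?d \<gamma>)"
    using gate_count[OF C z \<Gamma>(1), of ix] ix \<Gamma> by auto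
  moreover have "(\<Sum>\<gamma>\<in>\<Gamma>. ?d \<gamma>) = ?d p + ?d q + (?d r + ?d s)" using G by simp
  moreover have "?d p + ?d q \<le> c + 3" "?d r + ?d s \<le> c + 3" using pr G by auto
  ultimately show False using card_comp_edges_ge(2)[OF C z] card_E c_less_\<delta> by linarith
qed

end

section \<open>Components with exactly three gates\<close>

lemma card_3_nat:
  fixes I :: "nat set"
  assumes "card I = 3"
  obtains i j k where "i < j" "j < k" "I = {i, j, k}"
proof -
  obtain p q r where I: "I = {p, q, r}" "p \<noteq> q" "q \<noteq> r" "p \<noteq> r"
    using assms by (auto simp: card_3_iff)
  consider "p < q \<and> q < r" | "p < r \<and> r < q" | "q < p \<and> p < r" | "q < r \<and> r < p" | "r < p \<and> p < q" | "r < q \<and> q < p"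
    using I by linarith
  then show thesis
  proof cases
    case 1 then show ?thesis using that[of p q r] I by auto
  next
    case 2 then show ?thesis using that[of p r q] I by auto
  next
    case 3 then show ?thesis using that[of q p r] I by auto
  next
    case 4 then show ?thesis using that[of q r p] I by auto
  next
    case 5 then show ?thesis using that[of r p q] I by auto
  next
    case 6 then show ?thesis using that[of r q p] I by auto
  qed
qed

context longest_cycle begin

text \<open>If all connectors of two gates led to the same vertex p of the component, then p and the third
  gate would separate the rest of the component from the cycle.\<close>

lemma disjoint_connectors:
  assumes C: "cyc x y" and z: "z \<in> V - range x" and g: "\<gamma> \<in> gates x y z" "\<gamma>' \<in> gates x y z" "\<gamma> \<noteq> \<gamma>'"
    and K2: "2 \<le> card (comp x y z)"
  shows "\<exists>f\<in>connectors x y z \<gamma>. \<exists>h\<in>connectors x y z \<gamma>'.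
    \<exists>p\<in>f \<inter> comp x y z. \<exists>q\<in>h \<inter> comp x y z. f \<noteq> h \<and> p \<noteq> q"
proof (rule ccontr)
  let ?K = "comp x y z" and ?L = "comp_edges x y z"
  assume "\<not> ?thesis"
  then have no: "p = q" if "f \<in> connectors x y z \<gamma>" "h \<in> connectors x y z \<gamma>'" "f \<noteq> h"
    "p \<in> f \<inter> ?K" "q \<in> h \<inter> ?K" for f h p q
    using that by blast
  have meets: "f \<inter> ?K \<noteq> {}" if "f \<in> connectors x y z \<gamma>''" "\<gamma>'' \<in> gates x y z" for f \<gamma>''
  proof -
    obtain i where "gate_index x y z \<gamma>'' i" using gate_index_ex[OF C z] \<open>\<gamma>'' \<in> gates x y z\<close> by blast
    then show ?thesis using gate_index_connectors(2)[OF C z] \<open>\<gamma>'' \<in> gates x y z\<close> \<open>f \<in> _\<close> by blast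
  qed
  obtain f h where fh: "f \<in> connectors x y z \<gamma>" "h \<in> connectors x y z \<gamma>'" "f \<noteq> h"
    using distinct_connectors[OF g] by blast
  obtain p where p: "p \<in> f \<inter> ?K" using meets fh g by blast
  obtain q where q: "q \<in> h \<inter> ?K" using meets fh g by blast
  have f: "f \<inter> ?K = {p}" and h: "h \<inter> ?K = {p}"
    using no[OF fh] p q by blast+
  have all: "e \<inter> ?K = {p}" if "e \<in> connectors x y z \<gamma> \<union> connectors x y z \<gamma>'" for e
  proof (cases "e \<in> connectors x y z \<gamma>")
    case True
    show ?thesis
    proof (cases "e = h")
      case False
      then show ?thesis using no[OF True fh(2) False] meets[OF True g(1)] h by blast
    qed (use h in simp)
  next
    case False
    then have e: "e \<in> connectors x y z \<gamma>'" using that by blast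
    show ?thesis
    proof (cases "e = f")
      case False
      then show ?thesis using no[OF fh(1) e] meets[OF e g(2)] f by blast
    qed (use f in simp)
  qed
  have "card (gates x y z - {\<gamma>, \<gamma>'}) = 1"
    using card_gates_eq_3[OF C z] finite_gates[OF C z] g by (simp add: card_Diff_subset)
  then obtain t where t: "gates x y z - {\<gamma>, \<gamma>'} = {t}" by (auto simp: card_1_singleton_iff)
  have third: "g' = \<gamma> \<or> g' = \<gamma>' \<or> g' = t" if "g' \<in> gates x y z" for g' using t that by blast
  have tg: "t \<in> gates x y z" using t by blast
  \<comment> \<open>The third gate, sorted by kind: exactly one of \<open>TX\<close> and
    \<open>TY\<close> is a singleton, the other is empty.\<close>
  define TX where "TX = {v. t = Inl v}"
  define TY where "TY = {e. t = Inr e}"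
  define RX where "RX = ?K - {p}"
  define RY where "RY = {e \<in> ?L. e \<inter> RX \<noteq> {}} - TY"
  have K: "?K \<subseteq> V - range x" by (rule comp_sub[OF z])
  have TXr: "TX \<subseteq> range x" and TYE: "TY \<subseteq> E"
    using tg gate_sets(1-3)[OF C z] cyc_sub(2)[OF C] comp_edges_sub[of x y z] by (auto simp: gates_def TX_def TY_def)
  have sz: "card TX + card TY = 1"
    by (cases t) (auto simp: TX_def TY_def)
  have fTX: "finite TX" by (cases t) (auto simp: TX_def)
  have escape: "e \<inter> ?K = {p} \<or> e \<in> TY" if "Inr e \<in> gates x y z" for e
    using third[OF that] all[of e] by (auto simp: TY_def)
  have "V \<subseteq> RX \<union> insert p TX \<and> E \<subseteq> RY \<union> TY"
  proof (rule cut[of "insert p TX" TY RX RY])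
    show "insert p TX \<subseteq> V" "TY \<subseteq> E" "RX \<subseteq> V" "RY \<subseteq> E"
      using p K TXr TYE cyc_sub(1)[OF C] comp_edges_sub[of x y z] by (auto simp: RX_def RY_def)
    have "p \<notin> TX" using p K TXr by blast
    then show "card (insert p TX) + card TY \<le> 2" using sz fTX by simp
    show "RX \<inter> insert p TX = {}" "RY \<inter> TY = {}" using K TXr by (auto simp: RX_def RY_def)
    have "RX \<noteq> {}"
    proof
      assume "RX = {}"
      then have "?K \<subseteq> {p}" by (auto simp: RX_def)
      then show False using card_mono[of "{p}" ?K] K2 by simp
    qed
    then show "RX \<noteq> {} \<or> RY \<noteq> {}" by blast
    show "e \<in> RY \<union> TY" if ve: "v \<in> RX" "e \<in> E" "v \<in> e" for v e
    proof (cases "e \<in> range y")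
      case True
      then have "Inr e \<in> gates x y z" using ve by (auto simp: gates_def contact_edges_def RX_def)
      then show ?thesis using escape ve by (auto simp: RX_def)
    next
      case False
      then show ?thesis using ve edge_in_comp_edges[of v x y z e] by (auto simp: RX_def RY_def)
    qed
    show "v \<in> RX \<union> insert p TX" if ve: "e \<in> RY" "v \<in> e" for v e
    proof (cases "v \<in> range x")
      case False
      obtain w where "w \<in> ?K" "w \<in> e" "e \<in> E - range y" using ve by (auto simp: RY_def comp_edges_def)
      then show ?thesis using comp_closed[OF z, of w y e v] False ve by (auto simp: RX_def)
    next
      case True
      have e: "e \<in> links x y z v" "e \<notin> TY" "e \<inter> ?K \<noteq> {p}" using ve by (auto simp: RY_def RX_def links_def)
      from gates_cover[OF C z True e(1)] show ?thesis
      proof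
        assume "v \<in> gate_vertices x y z"
        then have "Inl v \<in> gates x y z" by (simp add: gates_def)
        then show ?thesis using third[of "Inl v"] all[of e] e by (auto simp: TX_def)
      next
        assume "links x y z v = {e} \<and> e \<in> gate_edges x y z"
        then have "Inr e \<in> gates x y z" by (simp add: gates_def)
        then show ?thesis using escape e by blast
      qed
    qed
  qed
  then have "range x \<subseteq> TX" using K p cyc_sub(1)[OF C] by (auto simp: RX_def)
  then have "c \<le> card TX" using card_mono[OF fTX, of "range x"] card_ranges(1)[OF C] by simp
  then show False using sz c_ge_2 by linarith
qed

text \<open>Reduces the three gates to their ordered positions, which divide the cycle into the
  three arcs to be counted.\<close>

lemma gate_total:
  assumes C: "cyc x y" and z: "z \<in> V - range x"
  obtains i j k where "i < j" "j < k" "k < c"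
    "\<forall>a\<in>{i, j, k}. \<forall>b\<in>{i, j, k}. a \<noteq> b \<longrightarrow>
      dg (range y) (x (Suc a)) + dg (range y) (x (Suc b)) \<le> c + 3"
    "3 * \<delta> + card (comp_edges x y z) + c \<le> card E + (dg (range y) (x (Suc i)) + dg (range y) (x (Suc j)) + dg (range y) (x (Suc k)))"
    "\<forall>a\<in>{i, j, k}. \<forall>b\<in>{i, j, k}. a \<noteq> b \<longrightarrow>
      (\<exists>\<gamma>\<in>gates x y z. \<exists>\<gamma>'\<in>gates x y z. \<gamma> \<noteq> \<gamma>' \<and> gate_index x y z \<gamma> a \<and> gate_index x y z \<gamma>' b)"
proof -
  obtain ix where ix: "\<And>\<gamma>. \<gamma> \<in> gates x y z \<Longrightarrow> gate_index x y z \<gamma> (ix \<gamma>)"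
    using gate_index_ex[OF C z] by metis
  have inj: "inj_on ix (gates x y z)"
    using gate_index_inj[OF C z] ix by (metis inj_onI)
  then have "card (ix ` gates x y z) = 3" using card_gates_eq_3[OF C z] by (simp add: card_image)
  then obtain i j k where I: "i < j" "j < k" "ix ` gates x y z = {i, j, k}" by (rule card_3_nat)
  have gt: "\<exists>\<gamma>\<in>gates x y z. a = ix \<gamma> \<and> gate_index x y z \<gamma> a" if "a \<in> {i, j, k}" for a
    using that ix unfolding I(3)[symmetric] by blast
  show thesis
  proof (rule that[OF I(1,2)])
    show "k < c" using gt[of k] by (auto simp: gate_index_def)
    have two: "\<exists>\<gamma>\<in>gates x y z. \<exists>\<gamma>'\<in>gates x y z. \<gamma> \<noteq> \<gamma>' \<and> gate_index x y z \<gamma> a \<and> gate_index x y z \<gamma>' b"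
      if ab: "a \<in> {i, j, k}" "b \<in> {i, j, k}" "a \<noteq> b" for a b
    proof -
      obtain \<gamma> \<gamma>' where g: "\<gamma> \<in> gates x y z" "a = ix \<gamma>" "gate_index x y z \<gamma> a"
        "\<gamma>' \<in> gates x y z" "b = ix \<gamma>'" "gate_index x y z \<gamma>' b"
        using gt[OF ab(1)] gt[OF ab(2)] by blast
      then have "\<gamma> \<noteq> \<gamma>'" using ab(3) by auto
      then show ?thesis using g by blast
    qed
    then show "\<forall>a\<in>{i, j, k}. \<forall>b\<in>{i, j, k}. a \<noteq> b \<longrightarrow>
      (\<exists>\<gamma>\<in>gates x y z. \<exists>\<gamma>'\<in>gates x y z. \<gamma> \<noteq> \<gamma>' \<and> gate_index x y z \<gamma> a \<and> gate_index x y z \<gamma>' b)"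
      by blast
    have "dg (range y) (x (Suc a)) + dg (range y) (x (Suc b)) \<le> c + 3"
      if ab: "a \<in> {i, j, k}" "b \<in> {i, j, k}" "a \<noteq> b" for a b
      using two[OF ab] gate_degree_sum[OF C z] by blast
    then show "\<forall>a\<in>{i, j, k}. \<forall>b\<in>{i, j, k}. a \<noteq> b \<longrightarrow>
      dg (range y) (x (Suc a)) + dg (range y) (x (Suc b)) \<le> c + 3" by blast
    have "(\<Sum>\<gamma>\<in>gates x y z. dg (range y) (x (Suc (ix \<gamma>)))) = (\<Sum>a\<in>{i, j, k}. dg (range y) (x (Suc a)))"
      using sum.reindex[OF inj, of "\<lambda>a. dg (range y) (x (Suc a))"] I(3) by (simp add: o_def)
    then show "3 * \<delta> + card (comp_edges x y z) + c \<le> card E + (dg (range y) (x (Suc i)) + dg (range y) (x (Suc j)) + dg (range y) (x (Suc k)))"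
      using gate_count[OF C z order_refl, of ix] ix card_gates_eq_3[OF C z] I by simp
  qed
qed

text \<open>The edges at a vertex of a component with at most two vertices are gates or distinct subsets of a
  set with at most five elements, so there are too few of them.\<close>

lemma card_comp_ge_3:
  assumes C: "cyc x y" and z: "z \<in> V - range x"
  shows "3 \<le> card (comp x y z)"
proof (rule ccontr)
  assume small: "\<not> 3 \<le> card (comp x y z)"
  let ?K = "comp x y z" and ?L = "comp_edges x y z"
  let ?X = "gate_vertices x y z" and ?G = "gate_edges x y z" and ?Y = "contact_edges x y z"
  note G = gate_sets[OF C z]
  have K: "?K \<subseteq> V - range x" by (rule comp_sub[OF z])
  have fK: "finite ?K" using K finite_V finite_subset by blast
  \<comment> \<open>All that an edge at \<open>z\<close> off the cycle can contain besides
    \<open>z\<close>, unless it is a gate edge: its cycle vertices must be gate vertices.\<close>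
  define T where "T = ?K \<union> ?X - {z}"
  have fT: "finite T" using fK G(4) by (simp add: T_def)
  have "card T \<le> card (?K - {z}) + card ?X"
    unfolding T_def using card_Un_le[of "?K - {z}" ?X] card_mono[of "(?K - {z}) \<union> ?X" "?K \<union> ?X - {z}"] fK G(4)
    by fastforce
  moreover have "card (?K - {z}) \<le> 1" using small comp_self[of z x y] fK by simp
  ultimately have cT: "card T \<le> card ?X + 1" by linarith
  have total: "card ?X + card ?G + card ?Y = 3" using card_gates_eq_3[OF C z] G(7) by simp
  define N where "N = card {s \<in> Pow T. 2 \<le> card s}"
  have NT: "N + 1 + card T = 2 ^ card T" unfolding N_def by (rule card_subsets_ge_2[OF fT])
  have dgY: "dg (range y) z \<le> card ?Y"
    unfolding dg_def using G(6) comp_self[of z x y] by (intro card_mono) (auto simp: contact_edges_def)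
  have "links x y z z \<subseteq> ?G \<union> insert z ` {s \<in> Pow T. 2 \<le> card s}"
  proof
    fix e assume e: "e \<in> links x y z z"
    then have eL: "e \<in> ?L" "z \<in> e" "e \<in> E - range y" using comp_edges_sub[of x y z] by (auto simp: links_def)
    have fe: "finite e" using eL E_Pow finite_V finite_subset by blast
    show "e \<in> ?G \<union> insert z ` {s \<in> Pow T. 2 \<le> card s}"
    proof (cases "e \<in> ?G")
      case False
      have "e \<subseteq> ?K \<union> ?X"
      proof
        fix v assume v: "v \<in> e"
        show "v \<in> ?K \<union> ?X"
        proof (cases "v \<in> range x")
          case True
          then show ?thesis using gates_cover[OF C z True, of e] v eL False by (auto simp: links_def)
        next
          case False
          then show ?thesis using comp_closed[OF z comp_self eL(3,2) v] by blast
        qed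
      qed
      then have "e - {z} \<in> Pow T" by (auto simp: T_def)
      moreover have "2 \<le> card (e - {z})" using card_edge[of e] eL fe by simp
      moreover have "e = insert z (e - {z})" using eL by blast
      ultimately show ?thesis by blast
    qed simp
  qed
  then have "card (links x y z z) \<le> card (?G \<union> insert z ` {s \<in> Pow T. 2 \<le> card s})"
    using G(5) fT by (intro card_mono) auto
  also have "\<dots> \<le> card ?G + N"
    unfolding N_def using fT by (intro order_trans[OF card_Un_le] add_mono card_image_le) auto
  finally have up: "\<delta> \<le> dg (range y) z + card ?G + N"
    using card_links_ge(1)[OF C z comp_self] by linarith
  obtain i j k where I: "i < j" "j < k" "k < c"
    and pr: "\<forall>a\<in>{i, j, k}. \<forall>b\<in>{i, j, k}. a \<noteq> b \<longrightarrow>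
      dg (range y) (x (Suc a)) + dg (range y) (x (Suc b)) \<le> c + 3"
    and tot: "3 * \<delta> + card ?L + c \<le> card E + (dg (range y) (x (Suc i)) + dg (range y) (x (Suc j)) + dg (range y) (x (Suc k)))"
    by (rule gate_total[OF C z])
  \<comment> \<open>Adding the three pair bounds gives at most \<open>3 * (c + 3)\<close> for twice
    the degree sum.\<close>
  have "11 \<le> c + 2 * dg (range y) z"
    using tot pr[rule_format, of i j] pr[rule_format, of j k] pr[rule_format, of i k] I card_E card_comp_edges_ge(1)[OF C z] by simp
  then have low: "12 \<le> \<delta> + 2 * dg (range y) z" using c_less_\<delta> by linarith
  \<comment> \<open>The tight case is three gate vertices: \<open>T\<close> has up to four elements,
    at most 11 of its subsets have two or more, so \<delta> is at most 11, one below the required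
    12.\<close>
  have "card ?X \<in> {0, 1, 2, 3}" "card T \<in> {0, 1, 2, 3, 4}" using total cT by auto
  then show False using NT up low total dgY cT by (auto simp: eval_nat_numeral)
qed

text \<open>Any two component vertices share at least
  \<open>2 * (\<delta> - 3) - card (comp_edges x y z)\<close>, hence four, edges. Joining
  \<open>p\<close> to \<open>q\<close> through a third vertex \<open>r\<close> has to avoid at most
  three edges at a time, namely \<open>f\<close>, \<open>h\<close> and the edge \<open>a\<close>
  already chosen.\<close>

lemma long_gate_ear:
  assumes C: "cyc x y" and z: "z \<in> V - range x"
    and L: "card (comp_edges x y z) + 10 \<le> 2 * \<delta>"
    and i: "\<exists>\<gamma>\<in>gates x y z. \<exists>\<gamma>'\<in>gates x y z. \<gamma> \<noteq> \<gamma>' \<and> gate_index x y z \<gamma> i \<and> gate_index x y z \<gamma>' k"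
  obtains vs es f h where "ear x y i k vs es f h" "3 \<le> length vs"
proof -
  let ?K = "comp x y z" and ?L = "comp_edges x y z"
  have K: "?K \<subseteq> V - range x" by (rule comp_sub[OF z])
  have K3: "3 \<le> card ?K" by (rule card_comp_ge_3[OF C z])
  obtain \<gamma> \<gamma>' where g: "\<gamma> \<in> gates x y z" "\<gamma>' \<in> gates x y z" "\<gamma> \<noteq> \<gamma>'"
    and gi: "gate_index x y z \<gamma> i" "gate_index x y z \<gamma>' k"
    using i by blast
  obtain f h p q where fh: "f \<in> connectors x y z \<gamma>" "h \<in> connectors x y z \<gamma>'" "f \<noteq> h" "p \<noteq> q"
    and pq: "p \<in> f \<inter> ?K" "q \<in> h \<inter> ?K"
    using disjoint_connectors[OF C z g] K3 by auto
  note F = gate_index_connectors[OF C z g(1) gi(1) fh(1)]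
  note H = gate_index_connectors[OF C z g(2) gi(2) fh(2)]
  have "\<not> ?K \<subseteq> {p, q}" using K3 card_mono[of "{p, q}" ?K] card_insert_le_m1[of 2 "{q}" p] by auto
  then obtain r where r: "r \<in> ?K" "r \<noteq> p" "r \<noteq> q" by blast
  have common: "4 \<le> card (links x y z a \<inter> links x y z b)" if "a \<in> ?K" "b \<in> ?K" for a b
  proof -
    have "finite ?L" using comp_edges_sub[of x y z] finite_E finite_subset by blast
    then have "card (links x y z a \<union> links x y z b) \<le> card ?L" by (intro card_mono) (auto simp: links_def)
    moreover have "card (links x y z a) + card (links x y z b)
        = card (links x y z a \<union> links x y z b) + card (links x y z a \<inter> links x y z b)"
      by (intro card_Un_Int finite_links)
    ultimately show ?thesis using card_links_ge(2)[OF C z that(1)] card_links_ge(2)[OF C z that(2)] L by linarith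
  qed
  have avoid: "\<exists>e\<in>S. e \<notin> set bs" if "4 \<le> card S" "length bs \<le> 3" for S :: "'a set set" and bs
  proof (rule ccontr)
    assume "\<not> ?thesis"
    then have "S \<subseteq> set bs" by blast
    then have "card S \<le> length bs" using card_mono[of "set bs" S] card_length[of bs] by simp
    then show False using that by simp
  qed
  obtain a where a: "a \<in> links x y z p \<inter> links x y z r" "a \<notin> set [f, h]"
    using avoid[OF common, of p r "[f, h]"] pq r by auto
  obtain b where b: "b \<in> links x y z r \<inter> links x y z q" "b \<notin> set [f, h, a]"
    using avoid[OF common, of r q "[f, h, a]"] pq r by auto
  have "bpath [p, r, q] [a, b]" using a b by (auto simp: bpath_def links_def less_Suc_eq)
  moreover have "p \<in> V" "q \<in> V" "r \<in> V" "a \<in> E" "b \<in> E"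
    using a(1) b(1) r(1) pq K comp_edges_sub[of x y z] by (auto simp: links_def)
  ultimately have "path [p, r, q] [a, b]"
    using b(2) fh(4) r(2,3) by (simp add: path_def) blast
  moreover have "f \<in> E" "h \<in> E" "f \<notin> range y \<or> f = y i" "h \<notin> range y \<or> h = y k"
    using F(3) H(3) cyc_sub(4)[OF C] comp_edges_sub[of x y z] by blast+
  moreover have "set [p, r, q] \<inter> range x = {}" using pq r K by auto
  moreover have "set [a, b] \<inter> range y = {}" using a b comp_edges_sub[of x y z] by (auto simp: links_def)
  ultimately have "ear x y i k [p, r, q] [a, b] f h"
    unfolding ear_def using fh F(1) H(1) pq a b by auto
  then show thesis by (rule that) simp
qed

lemma no_longest_cycle_shorter:
  assumes "cycle vs es" "length vs = c"
  shows False
proof -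
  obtain x y where C: "cyc x y" using cycle_cyc[OF assms] by blast
  have "card (range x) < card V" using card_ranges(1)[OF C] c_less by simp
  then obtain z where z: "z \<in> V - range x"
    using cyc_sub(1)[OF C] by (metis Diff_eq_empty_iff antisym ex_in_conv less_irrefl)
  let ?L = "comp_edges x y z" and ?d = "\<lambda>a. dg (range y) (x (Suc a))"
  obtain i j k where I: "i < j" "j < k" "k < c"
    and pr: "\<forall>a\<in>{i, j, k}. \<forall>b\<in>{i, j, k}. a \<noteq> b \<longrightarrow> ?d a + ?d b \<le> c + 3"
    and tot: "3 * \<delta> + card ?L + c \<le> card E + (?d i + ?d j + ?d k)"
    and gt: "\<forall>a\<in>{i, j, k}. \<forall>b\<in>{i, j, k}. a \<noteq> b \<longrightarrow>
      (\<exists>\<gamma>\<in>gates x y z. \<exists>\<gamma>'\<in>gates x y z. \<gamma> \<noteq> \<gamma>' \<and> gate_index x y z \<gamma> a \<and> gate_index x y z \<gamma>' b)"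
    by (rule gate_total[OF C z])
  have "?d k \<le> card (range y)"
    unfolding dg_def using cyc_sub(2)[OF C] finite_E by (intro card_mono) (auto intro: finite_subset)
  moreover have "c + 3 \<le> \<delta>"
  proof -
    have "card (range x \<union> comp x y z) = c + card (comp x y z)"
      using card_ranges(1)[OF C] comp_sub[OF z, of y] cyc_sub(1)[OF C] finite_V
      by (subst card_Un_disjoint) (auto intro: finite_subset)
    moreover have "card (range x \<union> comp x y z) \<le> card V"
      using comp_sub[OF z, of y] cyc_sub(1)[OF C] finite_V by (intro card_mono) auto
    ultimately show ?thesis using card_comp_ge_3[OF C z] card_V by linarith
  qed
  moreover have "?d i + ?d j \<le> c + 3" using pr[rule_format, of i j] I by simp
  \<comment> \<open>Two of the successors have degree sum at most \<open>c + 3\<close> and the third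
    has degree at most \<open>c\<close>; room for three outside vertices,
    \<open>c + 3 \<le> \<delta>\<close>, does the rest.\<close>
  ultimately have L: "card ?L + 10 \<le> 2 * \<delta>"
    using tot card_E card_ranges(2)[OF C] by linarith
  obtain vs1 es1 f1 h1 where e1: "ear x y i j vs1 es1 f1 h1" "3 \<le> length vs1"
    by (rule long_gate_ear[OF C z L gt[rule_format, of i j]]) (use I in auto)
  obtain vs2 es2 f2 h2 where e2: "ear x y i k vs2 es2 f2 h2" "3 \<le> length vs2"
    by (rule long_gate_ear[OF C z L gt[rule_format, of i k]]) (use I in auto)
  obtain vs3 es3 f3 h3 where e3: "ear x y j k vs3 es3 f3 h3" "3 \<le> length vs3"
    by (rule long_gate_ear[OF C z L gt[rule_format, of j k]]) (use I in auto)
  have "?d i + ?d j + ?d k \<le> c + 6"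
    by (rule long_ears_degree_sum[OF C I(1,2) _ e1 e2 e3]) (use I in simp)
  \<comment> \<open>With at least \<open>\<delta> - 3\<close> component edges the count would
    require \<open>4 * \<delta> - 3 + c \<le> 4 * \<delta> - 10 + c + 6\<close>, which fails by
    one.\<close>
  then show False using tot card_E card_comp_edges_ge(2)[OF C z] by linarith
qed

end

section \<open>A cycle of maximal length is hamiltonian\<close>

context dirac_hypergraph begin

lemma hamiltonian: "has_hamiltonian_berge_cycle V E"
proof -
  define Len where "Len = {length vs | vs es. cycle vs es}"
  have le: "length vs \<le> card V" if "cycle vs es" for vs es
    using that distinct_card[of vs] card_mono[OF finite_V, of "set vs"] by (auto simp: cycle_def)
  then have fin: "finite Len" by (intro finite_subset[of Len "{..card V}"]) (auto simp: Len_def)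
  obtain vs0 es0 where c0: "cycle vs0 es0" "2 \<le> length vs0" using cycle_ex by blast
  then have in0: "length vs0 \<in> Len" by (auto simp: Len_def)
  then have "Max Len \<in> Len" using fin Max_in by blast
  then obtain vs es where C: "cycle vs es" "length vs = Max Len" by (auto simp: Len_def)
  have mx: "length vs' \<le> Max Len" if "cycle vs' es'" for vs' es'
    using fin that by (intro Max_ge) (auto simp: Len_def)
  have "\<not> length vs < card V"
  proof
    assume "length vs < card V"
    then interpret longest_cycle V E \<delta> "length vs"
      using c0 mx C by unfold_locales (auto intro: order_trans)
    show False using no_longest_cycle_shorter[OF C(1)] by blast
  qed
  then have "set vs = V"
    using C(1) distinct_card[of vs] by (intro card_subset_eq finite_V) (auto simp: cycle_def le_antisym le[OF C(1)])
  then show ?thesis using cycle_berge[OF C(1)] by (auto simp: has_hamiltonian_berge_cycle_def)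
qed

end

theorem theorem1p6:
  fixes n m \<delta> :: nat and V :: "'a set" and E :: "'a set set"
  assumes "0 < n" and "0 < m" and "0 < \<delta>"
    and "real \<delta> \<ge> max (real n) ((real m + 10) / 4)"
    and "hypergraph V E"
    and "card V = n" and "card E = m"
    and "k_connected_hypergraph 3 V E"
    and "min_hdegree V E \<ge> \<delta>"
  shows "has_hamiltonian_berge_cycle V E"
proof -
  have fin: "finite V" and EV: "E \<subseteq> Pow V"
    using assms(5) by (auto simp: hypergraph_def)
  have nm: "n \<le> \<delta>" "m + 10 \<le> 4 * \<delta>" using assms(4) by auto
  interpret dirac_hypergraph V E \<delta>
  proof
    show "finite V" "E \<subseteq> Pow V" by fact+
    show "V \<noteq> {}" using assms(1,6) by auto
    show "card V \<le> \<delta>" "card E + 10 \<le> 4 * \<delta>" using nm assms(6,7) by auto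
    show "\<delta> \<le> card {e \<in> E. v \<in> e}" if "v \<in> V" for v
    proof -
      have "Min (hdegree E ` V) \<le> hdegree E v" using fin that by (intro Min_le) auto
      then show ?thesis using assms(9) by (simp add: min_hdegree_def hdegree_def)
    qed
  next
    fix SX SY RX RY
    assume "SX \<subseteq> V" "SY \<subseteq> E" "RX \<subseteq> V" "RY \<subseteq> E" "card SX + card SY \<le> 2"
      "RX \<inter> SX = {}" "RY \<inter> SY = {}" "RX \<noteq> {} \<or> RY \<noteq> {}"
      "\<And>v e. v \<in> RX \<Longrightarrow> e \<in> E \<Longrightarrow> v \<in> e \<Longrightarrow> e \<in> RY \<union> SY"
      "\<And>v e. e \<in> RY \<Longrightarrow> v \<in> e \<Longrightarrow> v \<in> RX \<union> SX"
    then show "V \<subseteq> RX \<union> SX \<and> E \<subseteq> RY \<union> SY"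
      by (rule three_connected_cut[OF assms(5,8)])
  qed
  show ?thesis by (rule hamiltonian)
qed

end
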